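(* Let $\Theta=(\Gamma,(x_{k,i}))$ be a patch framework with $\Gamma$ connected and with every view affinely non-degenerate. Let $S$ be a perfect alignment. Then the realization $\Theta(S)$ is locally rigid if and only if $\pi(S)$ is a strict global minimum of $\widetilde F$. Consequently, if $S$ is a non-degenerate perfect alignment then $\Theta(S)$ is locally rigid, and the converse holds if $\Theta(S)$ is generic.
   Context: Patch framework. $\Gamma$ is a bipartite graph on $n+m$ vertices; vertex $k\in\{1,\dots,n\}$ represents the $k$th point and vertex $n+i$, $i\in\{1,\dots,m\}$, the $i$th view; $(k,i)\in E(\Gamma)$ means that point $k$ is in view $i$, with local coordinates $x_{k,i}\in\mathbb{R}^d$. The tuple $\Theta=(\Gamma,(x_{k,i}))$ is a patch framework. A view $i$ is affinely non-degenerate if it has at least $d+1$ points and the affine span of $\{x_{k,i}:(k,i)\in E(\Gamma)\}$ has dimension $d$. Put $e_{ki}=e_k-e_{n+i}\in\mathbb{R}^{n+m}$, $\varepsilon_i$ the $i$th standard basis vector of $\mathbb{R}^m$, $\mathcal{L}_\Gamma=\sum_{(k,i)\in E(\Gamma)}e_{ki}e_{ki}^T$, $B=\sum_{(k,i)\in E(\Gamma)}(\varepsilon_i\otimes I_d)x_{k,i}e_{ki}^T$, $D=\sum_{(k,i)\in E(\Gamma)}(\varepsilon_i\otimes I_d)x_{k,i}x_{k,i}^T(\varepsilon_i\otimes I_d)^T$, and $C=D-B\mathcal{L}_\Gamma^\dagger B^T\in\mathbb{R}^{md\times md}$ (positive semi-definite), where $\dagger$ is the Moore–Penrose pseudoinverse.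 An alignment is an element $S=[S_i]_1^m$ (vertical stack) of $\mathbb{O}(d)^m\subseteq\mathbb{R}^{md\times d}$; $F(S)=\mathrm{Tr}(CSS^T)$; $S$ is perfect if $F(S)=0$. Let $\pi:\mathbb{O}(d)^m\to\mathbb{O}(d)^{m-1}$, $\pi(S)=[S_{i+1}S_1^T]_{i=1}^{m-1}$ (identifying $\mathbb{O}(d)^m/_\sim$, $S\sim SQ$ for $Q\in\mathbb{O}(d)$, with $\mathbb{O}(d)^{m-1}$), and $\widetilde F:\mathbb{O}(d)^{m-1}\to\mathbb{R}$, $\widetilde F(\widetilde S)=\mathrm{Tr}\left(C\begin{bmatrix}I_d\\ \widetilde S\end{bmatrix}\begin{bmatrix}I_d\\ \widetilde S\end{bmatrix}^T\right)$, so $F=\widetilde F\circ\pi$. $S$ is non-degenerate if $\pi(S)$ is a local minimizer of $\widetilde F$ at which the Hessian is non-singular (at a critical point this does not depend on the Riemannian metric). A global minimizer $\widetilde S$ of $\widetilde F$ is strict if it has a neighbourhood $U$ with $\widetilde F(\widetilde O)>\widetilde F(\widetilde S)$ for all $\widetilde O\in U\setminus\{\widetilde S\}$. Realization. For an alignment $S$, $\Theta(S)=S^TB\,\mathcal{L}_\Gamma^\dagger(:,1{:}n)\,(I_n-n^{-1}\mathbf{1}_n\mathbf{1}_n^T)\in\mathbb{R}^{d\times n}$, where $(:,1{:}n)$ denotes the first $n$ columns and $\mathbf{1}_n$ the all-ones vector; so $\Theta(SQ)=Q^T\Theta(S)$ for $Q\in\mathbb{O}(d)$. When $S$ is perfect,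 $\Theta(S)$ is called a realization. For a perfect alignment $S$, $\Theta(S)$ is locally rigid if there exists $\epsilon>0$ such that for every perfect alignment $O$ with $\|\Theta(O)-\Theta(S)\|_F<\epsilon$ there is $Q\in\mathbb{O}(d)$ with $\Theta(O)=\Theta(SQ)$. $\Theta(S)$ is generic if the coordinates of its points (columns) do not satisfy any non-zero algebraic equation with rational coefficients. *)

theory Defs
  imports "HOL-Analysis.Analysis" "HOL-Library.Poly_Mapping"
begin

text \<open>
  Points are indexed by the finite type \<^typ>\<open>'n\<close>, views by the finite type \<^typ>\<open>'m\<close>, and
  coordinates by the finite type \<^typ>\<open>'d\<close>.  A patch framework consists of the edge set
  \<open>E :: ('n \<times> 'm) set\<close> of the bipartite graph and the local coordinates
  \<open>x :: 'n \<Rightarrow> 'm \<Rightarrow> real^'d\<close>, of which only the values on \<open>E\<close> are ever used.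
  Vertices of the graph are the elements of \<^typ>\<open>'n + 'm\<close>.
\<close>

subsection \<open>Patch frameworks\<close>

definition graph_adj :: "('n \<times> 'm) set \<Rightarrow> (('n + 'm) \<times> ('n + 'm)) set" where
  "graph_adj E = {(Inl k, Inr i) | k i. (k, i) \<in> E} \<union> {(Inr i, Inl k) | k i. (k, i) \<in> E}"

definition graph_connected :: "('n \<times> 'm) set \<Rightarrow> bool" where
  "graph_connected E \<longleftrightarrow> (\<forall>u v. (u, v) \<in> (graph_adj E)\<^sup>*)"

definition view_points :: "('n \<times> 'm) set \<Rightarrow> 'm \<Rightarrow> 'n set" where
  "view_points E i = {k. (k, i) \<in> E}"

definition affinely_nondegenerate ::
  "('n::finite \<times> 'm) set \<Rightarrow> ('n \<Rightarrow> 'm \<Rightarrow> real^'d) \<Rightarrow> 'm \<Rightarrow> bool" where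
  "affinely_nondegenerate E x i \<longleftrightarrow>
     card (view_points E i) \<ge> CARD('d) + 1 \<and>
     aff_dim (affine hull ((\<lambda>k. x k i) ` view_points E i)) = int CARD('d)"

subsection \<open>The matrices of a patch framework\<close>

definition outer :: "real^'a \<Rightarrow> real^'b \<Rightarrow> real^'b^'a" where
  "outer u v = (\<chi> i j. u $ i * v $ j)"

definition moore_penrose :: "real^'b^'a \<Rightarrow> real^'a^'b \<Rightarrow> bool" where
  "moore_penrose A X \<longleftrightarrow>
     A ** X ** A = A \<and> X ** A ** X = X \<and>
     transpose (A ** X) = A ** X \<and> transpose (X ** A) = X ** A"

definition pinv :: "real^'b^'a \<Rightarrow> real^'a^'b" where
  "pinv A = (THE X. moore_penrose A X)"

definition edge_vec :: "'n::finite \<Rightarrow> 'm::finite \<Rightarrow> real^('n + 'm)" where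
  "edge_vec k i = axis (Inl k) 1 - axis (Inr i) 1"

text \<open>The Kronecker product \<open>\<epsilon>\<^sub>i \<otimes> I\<^sub>d\<close>, with rows indexed by (view, coordinate).\<close>

definition view_block :: "'m::finite \<Rightarrow> real^'d^('m \<times> 'd)" where
  "view_block i = (\<chi> p b. axis i 1 $ fst p * mat 1 $ snd p $ b)"

definition mat_L :: "('n::finite \<times> 'm::finite) set \<Rightarrow> real^('n + 'm)^('n + 'm)" where
  "mat_L E = (\<Sum>(k, i)\<in>E. outer (edge_vec k i) (edge_vec k i))"

definition mat_B :: "('n::finite \<times> 'm::finite) set \<Rightarrow> ('n \<Rightarrow> 'm \<Rightarrow> real^'d)
    \<Rightarrow> real^('n + 'm)^('m \<times> 'd)" where
  "mat_B E x = (\<Sum>(k, i)\<in>E. view_block i ** outer (x k i) (edge_vec k i))"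

definition mat_D :: "('n::finite \<times> 'm::finite) set \<Rightarrow> ('n \<Rightarrow> 'm \<Rightarrow> real^'d)
    \<Rightarrow> real^('m \<times> 'd)^('m \<times> 'd)" where
  "mat_D E x =
     (\<Sum>(k, i)\<in>E. view_block i ** outer (x k i) (x k i) ** transpose (view_block i))"

definition mat_C :: "('n::finite \<times> 'm::finite) set \<Rightarrow> ('n \<Rightarrow> 'm \<Rightarrow> real^'d)
    \<Rightarrow> real^('m \<times> 'd)^('m \<times> 'd)" where
  "mat_C E x = mat_D E x - mat_B E x ** pinv (mat_L E) ** transpose (mat_B E x)"

subsection \<open>Alignments\<close>

text \<open>An alignment is given by its blocks; \<open>vstack\<close> is the corresponding \<open>md \<times> d\<close> matrix.\<close>

definition vstack :: "real^'d^'d^'m \<Rightarrow> real^'d^('m \<times> 'd)" where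
  "vstack S = (\<chi> p b. S $ fst p $ snd p $ b)"

definition alignment :: "real^'d^'d^'m \<Rightarrow> bool" where
  "alignment S \<longleftrightarrow> (\<forall>i. orthogonal_matrix (S $ i))"

definition align_error :: "('n::finite \<times> 'm::finite) set \<Rightarrow> ('n \<Rightarrow> 'm \<Rightarrow> real^'d)
    \<Rightarrow> real^'d^'d^'m \<Rightarrow> real" where
  "align_error E x S = trace (mat_C E x ** vstack S ** transpose (vstack S))"

definition perfect :: "('n::finite \<times> 'm::finite) set \<Rightarrow> ('n \<Rightarrow> 'm \<Rightarrow> real^'d)
    \<Rightarrow> real^'d^'d^'m \<Rightarrow> bool" where
  "perfect E x S \<longleftrightarrow> alignment S \<and> align_error E x S = 0"

definition right_mult :: "real^'d^'d^'m \<Rightarrow> real^'d^'d \<Rightarrow> real^'d^'d^'m" where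
  "right_mult S Q = (\<chi> i. S $ i ** Q)"

subsection \<open>The quotient by the right action of the orthogonal group\<close>

text \<open>
  Fix a reference view \<open>r\<close> (the first view).  The product of one copy of the orthogonal group for
  each of the other \<open>m - 1\<close> views is realised inside \<^typ>\<open>real^'d^'d^'m\<close> by keeping block \<open>r\<close>
  constantly equal to the identity; this includes the case \<open>m = 1\<close>, where it is a single point.
  Block \<open>r\<close> is a dummy: \<open>with_id r T\<close> is the stack of \<open>I\<^sub>d\<close> (in position \<open>r\<close>) and the
  remaining blocks of \<open>T\<close>, and \<open>red_error\<close> does not depend on block \<open>r\<close> of its argument.
\<close>

definition reduced_alignments :: "'m::finite \<Rightarrow> (real^'d^'d^'m) set" where
  "reduced_alignments r = {T. T $ r = mat 1 \<and> (\<forall>i. i \<noteq> r \<longrightarrow> orthogonal_matrix (T $ i))}"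

definition quot_proj :: "'m::finite \<Rightarrow> real^'d^'d^'m \<Rightarrow> real^'d^'d^'m" where
  "quot_proj r S = (\<chi> i. if i = r then mat 1 else S $ i ** transpose (S $ r))"

definition with_id :: "'m::finite \<Rightarrow> real^'d^'d^'m \<Rightarrow> real^'d^'d^'m" where
  "with_id r T = (\<chi> i. if i = r then mat 1 else T $ i)"

definition red_error :: "('n::finite \<times> 'm::finite) set \<Rightarrow> ('n \<Rightarrow> 'm \<Rightarrow> real^'d) \<Rightarrow> 'm
    \<Rightarrow> real^'d^'d^'m \<Rightarrow> real" where
  "red_error E x r T =
     trace (mat_C E x ** vstack (with_id r T) ** transpose (vstack (with_id r T)))"

definition strict_global_min :: "('n::finite \<times> 'm::finite) set \<Rightarrow> ('n \<Rightarrow> 'm \<Rightarrow> real^'d) \<Rightarrow> 'm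
    \<Rightarrow> real^'d^'d^'m \<Rightarrow> bool" where
  "strict_global_min E x r T \<longleftrightarrow>
     T \<in> reduced_alignments r \<and>
     (\<forall>X \<in> reduced_alignments r. red_error E x r T \<le> red_error E x r X) \<and>
     (\<exists>U. openin (top_of_set (reduced_alignments r)) U \<and> T \<in> U \<and>
          (\<forall>X \<in> U - {T}. red_error E x r X > red_error E x r T))"

definition local_min :: "('n::finite \<times> 'm::finite) set \<Rightarrow> ('n \<Rightarrow> 'm \<Rightarrow> real^'d) \<Rightarrow> 'm
    \<Rightarrow> real^'d^'d^'m \<Rightarrow> bool" where
  "local_min E x r T \<longleftrightarrow>
     T \<in> reduced_alignments r \<and>
     (\<exists>U. openin (top_of_set (reduced_alignments r)) U \<and> T \<in> U \<and>
          (\<forall>X \<in> U. red_error E x r T \<le> red_error E x r X))"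

text \<open>
  Tangent vectors at \<open>T\<close>: the blocks satisfy the derivative of \<open>X\<^sup>T X = I\<close>.
\<close>

definition reduced_tangent :: "'m::finite \<Rightarrow> real^'d^'d^'m \<Rightarrow> (real^'d^'d^'m) set" where
  "reduced_tangent r T =
     {V. V $ r = 0 \<and> (\<forall>i. transpose (T $ i) ** V $ i + transpose (V $ i) ** T $ i = 0)}"

text \<open>
  The Hessian at a critical point \<open>T\<close> is the bilinear form \<open>(V, W) \<mapsto> V (W' F)\<close>, where
  \<open>W'\<close> is any vector field on the manifold extending \<open>W\<close>.  We take the right-invariant field
  \<open>X \<mapsto> (W\<^sub>i T\<^sub>i\<^sup>T X\<^sub>i)\<^sub>i\<close>: for \<open>W\<close> tangent at \<open>T\<close> the matrices \<open>W\<^sub>i T\<^sub>i\<^sup>T\<close> are skew, so it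
  is tangent at every \<open>X\<close> of the manifold.  Since all fields involved are tangent, the Frechet
  derivatives of the ambient (polynomial) function compute the derivatives on the manifold.
\<close>

definition right_inv_field :: "real^'d^'d^'m \<Rightarrow> real^'d^'d^'m \<Rightarrow> real^'d^'d^'m \<Rightarrow> real^'d^'d^'m"
  where
  "right_inv_field T W X = (\<chi> i. W $ i ** transpose (T $ i) ** X $ i)"

definition hessian :: "(real^'d^'d^'m \<Rightarrow> real) \<Rightarrow> real^'d^'d^'m
    \<Rightarrow> real^'d^'d^'m \<Rightarrow> real^'d^'d^'m \<Rightarrow> real" where
  "hessian f T V W =
     frechet_derivative (\<lambda>X. frechet_derivative f (at X) (right_inv_field T W X)) (at T) V"

definition hessian_nonsingular :: "'m::finite \<Rightarrow> (real^'d^'d^'m \<Rightarrow> real) \<Rightarrow> real^'d^'d^'m \<Rightarrow> bool"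
  where
  "hessian_nonsingular r f T \<longleftrightarrow>
     (\<forall>V \<in> reduced_tangent r T. (\<forall>W \<in> reduced_tangent r T. hessian f T V W = 0) \<longrightarrow> V = 0)"

definition nondegenerate :: "('n::finite \<times> 'm::finite) set \<Rightarrow> ('n \<Rightarrow> 'm \<Rightarrow> real^'d) \<Rightarrow> 'm
    \<Rightarrow> real^'d^'d^'m \<Rightarrow> bool" where
  "nondegenerate E x r S \<longleftrightarrow>
     alignment S \<and> local_min E x r (quot_proj r S) \<and>
     hessian_nonsingular r (red_error E x r) (quot_proj r S)"

subsection \<open>Realizations\<close>

definition point_columns :: "real^('n::finite + 'm::finite)^'a \<Rightarrow> real^'n^'a" where
  "point_columns A = (\<chi> a k. A $ a $ Inl k)"

definition centering :: "real^'n^'n" where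
  "centering = mat 1 - (1 / real CARD('n)) *\<^sub>R outer 1 1"

definition realization :: "('n::finite \<times> 'm::finite) set \<Rightarrow> ('n \<Rightarrow> 'm \<Rightarrow> real^'d)
    \<Rightarrow> real^'d^'d^'m \<Rightarrow> real^'n^'d" where
  "realization E x S =
     transpose (vstack S) ** mat_B E x ** point_columns (pinv (mat_L E)) ** centering"

text \<open>\<^const>\<open>norm\<close> on \<^typ>\<open>real^'n^'d\<close> is the Frobenius norm.\<close>

definition locally_rigid :: "('n::finite \<times> 'm::finite) set \<Rightarrow> ('n \<Rightarrow> 'm \<Rightarrow> real^'d)
    \<Rightarrow> real^'d^'d^'m \<Rightarrow> bool" where
  "locally_rigid E x S \<longleftrightarrow>
     (\<exists>\<epsilon>>0. \<forall>O'. perfect E x O' \<and> norm (realization E x O' - realization E x S) < \<epsilon> \<longrightarrow>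
        (\<exists>Q. orthogonal_matrix Q \<and> realization E x O' = realization E x (right_mult S Q)))"

subsection \<open>Generic configurations\<close>

text \<open>
  \<^typ>\<open>('v \<Rightarrow>\<^sub>0 nat) \<Rightarrow>\<^sub>0 rat\<close> is the ring of polynomials in the variables \<^typ>\<open>'v\<close> with
  rational coefficients (finitely supported maps from exponent vectors to coefficients).
\<close>

definition eval_rat_poly :: "(('v::finite \<Rightarrow>\<^sub>0 nat) \<Rightarrow>\<^sub>0 rat) \<Rightarrow> ('v \<Rightarrow> real) \<Rightarrow> real" where
  "eval_rat_poly P y =
     (\<Sum>\<alpha>\<in>Poly_Mapping.keys P.
        of_rat (Poly_Mapping.lookup P \<alpha>) * (\<Prod>v\<in>UNIV. y v ^ Poly_Mapping.lookup \<alpha> v))"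

definition generic :: "real^'n^'d \<Rightarrow> bool" where
  "generic p \<longleftrightarrow>
     (\<forall>P :: (('d \<times> 'n) \<Rightarrow>\<^sub>0 nat) \<Rightarrow>\<^sub>0 rat.
        P \<noteq> 0 \<longrightarrow> eval_rat_poly P (\<lambda>v. p $ fst v $ snd v) \<noteq> 0)"

definition translate :: "real^'d \<Rightarrow> real^'n^'d \<Rightarrow> real^'n^'d" where
  "translate t p = (\<chi> a k. p $ a $ k + t $ a)"

text \<open>
  The columns of a realization always sum to zero, which is itself an algebraic equation with
  rational coefficients.  So no realization is generic in the sense of \<^const>\<open>generic\<close> (lemma
  \<open>realization_not_generic\<close>), and genericity of a realization has to be understood up to a common
  translation of its points: some translate of it is \<^const>\<open>generic\<close>.  The untranslated
  condition is the special case \<open>t = 0\<close>.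
\<close>

definition generic_up_to_translation :: "real^'n^'d \<Rightarrow> bool" where
  "generic_up_to_translation p \<longleftrightarrow> (\<exists>t. generic (translate t p))"

lemma generic_imp_generic_up_to_translation:
  assumes "generic p"
  shows "generic_up_to_translation p"
proof -
  have "translate 0 p = p"
    by (simp add: translate_def vec_eq_iff)
  with assms show ?thesis
    unfolding generic_up_to_translation_def by metis
qed

lemma realization_row_sum:
  fixes x :: "'n::finite \<Rightarrow> 'm::finite \<Rightarrow> real^'d"
  shows "(\<Sum>k\<in>UNIV. realization E x S $ a $ k) = 0"
proof -
  have c: "(\<Sum>k\<in>UNIV. (centering :: real^'n^'n) $ l $ k) = 0" for l
    by (simp add: centering_def outer_def mat_def sum_subtractf)
  have "(\<Sum>k\<in>UNIV. (M ** (centering :: real^'n^'n)) $ a $ k) = 0" for M :: "real^'n^'d"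
  proof -
    have "(\<Sum>k\<in>UNIV. (M ** (centering :: real^'n^'n)) $ a $ k)
        = (\<Sum>k\<in>UNIV. \<Sum>l\<in>UNIV. M $ a $ l * (centering :: real^'n^'n) $ l $ k)"
      by (simp add: matrix_matrix_mult_def)
    also have "\<dots> = (\<Sum>l\<in>UNIV. \<Sum>k\<in>UNIV. M $ a $ l * (centering :: real^'n^'n) $ l $ k)"
      by (rule sum.swap)
    also have "\<dots> = 0"
      by (simp add: sum_distrib_left [symmetric] c)
    finally show ?thesis .
  qed
  then show ?thesis
    by (simp add: realization_def)
qed

lemma realization_not_generic:
  fixes x :: "'n::finite \<Rightarrow> 'm::finite \<Rightarrow> real^'d"
  shows "\<not> generic (realization E x S)"
proof
  assume g: "generic (realization E x S)"
  obtain a :: 'd where True by blast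
  define X :: "'n \<Rightarrow> ('d \<times> 'n) \<Rightarrow>\<^sub>0 nat" where "X k = Poly_Mapping.single (a, k) 1" for k
  have lX: "Poly_Mapping.lookup (X k) v = (if v = (a, k) then 1 else 0)" for k v
    by (simp add: X_def lookup_single when_def)
  have inj: "X k = X l \<longleftrightarrow> k = l" for k l
    using lX [of k "(a, k)"] lX [of l "(a, k)"] by (auto split: if_splits)
  define P :: "(('d \<times> 'n) \<Rightarrow>\<^sub>0 nat) \<Rightarrow>\<^sub>0 rat"
    where "P = (\<Sum>k\<in>UNIV. Poly_Mapping.single (X k) 1)"
  have lP: "Poly_Mapping.lookup P \<alpha> = (if \<alpha> \<in> range X then 1 else 0)" for \<alpha>
  proof -
    have "Poly_Mapping.lookup P \<alpha> = (\<Sum>k\<in>UNIV. if X k = \<alpha> then 1 else 0)"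
      by (simp add: P_def lookup_sum lookup_single when_def)
    also have "\<dots> = (if \<alpha> \<in> range X then 1 else 0)"
    proof (cases "\<alpha> \<in> range X")
      case True
      then obtain l where "\<alpha> = X l" by blast
      then show ?thesis by (simp add: inj)
    next
      case False
      then have "X k \<noteq> \<alpha>" for k by blast
      then show ?thesis using False by simp
    qed
    finally show ?thesis .
  qed
  have keys: "Poly_Mapping.keys P = range X"
    by (auto simp: in_keys_iff lP split: if_splits)
  then have "P \<noteq> 0" by auto
  let ?y = "\<lambda>v. realization E x S $ fst v $ snd v"
  have pr: "(\<Prod>v\<in>UNIV. ?y v ^ Poly_Mapping.lookup (X k) v) = ?y (a, k)" for k
  proof -
    have "(\<Prod>v\<in>UNIV. ?y v ^ Poly_Mapping.lookup (X k) v) =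
        (\<Prod>v\<in>UNIV. if v = (a, k) then ?y v else 1)"
      by (rule prod.cong) (auto simp: lX)
    then show ?thesis by simp
  qed
  have "eval_rat_poly P ?y = (\<Sum>k\<in>UNIV. ?y (a, k))"
    unfolding eval_rat_poly_def keys
    by (subst sum.reindex) (auto simp: inj_def inj lP pr)
  also have "\<dots> = 0"
    by (simp add: realization_row_sum)
  finally show False
    using g \<open>P \<noteq> 0\<close> unfolding generic_def by blast
qed

end

theory Submission
  imports Defs
begin

text \<open>
  The error of a stack \<open>Y\<close> is the squared norm of a residual that is linear in \<open>Y\<close>, so perfect
  alignments are the stacks of orthogonal matrices in a linear subspace \<open>K\<close>.  A stack in \<open>K\<close>
  carries the views affinely onto one common configuration, its realization, which determines
  the stack because the views span.  Realization is thus a linear isomorphism of \<open>K\<close> onto its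
  image, equivariant under the orthogonal group, and local rigidity says that \<open>\<pi>(S)\<close> is
  isolated among the zeros of the reduced error.  At such a zero the Hessian is twice the Gram
  form of the residual, hence it is singular exactly when a nonzero tangent vector lies in \<open>K\<close>,
  i.e. when the realization has a nontrivial infinitesimal flex.  At a generic configuration the
  Jacobian of the map of squared distances has maximal rank, so an infinitesimal flex is the
  velocity of an actual motion preserving the distances within the views, which local rigidity
  excludes.
\<close>

subsection \<open>Rational polynomial functions and generic points\<close>

text \<open>Genericity enters only as maximality of a rank. The entries of the Jacobian of squared
  distances are linear forms with integer coefficients in the coordinates, so a minor that is
  nonzero at some configuration is nonzero at a generic one. Realizations are centred, hence the
  generic point is a translate; in-view distances do not see the translation and
  \<open>centering\<close> removes it again.

  Maximal rank has to replace surjectivity: the distance map usually has many more components than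
  independent ones, so its fibres are not given directly by the implicit function theorem.
  Composition with the transposed Jacobian, completed on the kernel, brings it within reach of the
  inverse function theorem.

  The link between points and alignments is that a view whose points span has its block determined
  by those points. A motion preserving in-view distances therefore moves each view by an orthogonal
  matrix and lifts to perfect alignments. Connectedness makes the Laplacian kernel the constants, so
  the pseudoinverse solves for points and view translations up to one common translation.\<close>

definition rat_polynomial :: "(('v::finite \<Rightarrow> real) \<Rightarrow> real) \<Rightarrow> bool" where
  "rat_polynomial f \<longleftrightarrow> (\<exists>P. f = eval_rat_poly P)"

lemma eval_rat_poly_superset:
  assumes "finite A" "Poly_Mapping.keys P \<subseteq> A"
  shows "eval_rat_poly P y =
    (\<Sum>\<alpha>\<in>A. of_rat (Poly_Mapping.lookup P \<alpha>) * (\<Prod>v\<in>UNIV. y v ^ Poly_Mapping.lookup \<alpha> v))"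
  unfolding eval_rat_poly_def
  using assms by (intro sum.mono_neutral_left) (auto simp: in_keys_iff)

lemma eval_rat_poly_add: "eval_rat_poly (P + Q) y = eval_rat_poly P y + eval_rat_poly Q y"
proof -
  let ?A = "Poly_Mapping.keys P \<union> Poly_Mapping.keys Q"
  have "finite ?A" "Poly_Mapping.keys (P + Q) \<subseteq> ?A"
    by (auto simp: Poly_Mapping.keys_add)
  then show ?thesis
    by (simp add: eval_rat_poly_superset[of ?A] lookup_add of_rat_add distrib_right sum.distrib)
qed

lemma eval_rat_poly_single:
  "eval_rat_poly (Poly_Mapping.single \<alpha> c) y =
    of_rat c * (\<Prod>v\<in>UNIV. y v ^ Poly_Mapping.lookup \<alpha> v)"
  by (simp add: eval_rat_poly_superset[of "{\<alpha>}"])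

lemma rat_polynomial_monomial:
  "rat_polynomial (\<lambda>y. of_rat c * (\<Prod>v\<in>UNIV. y v ^ Poly_Mapping.lookup \<alpha> v))"
  unfolding rat_polynomial_def
  by (rule exI[of _ "Poly_Mapping.single \<alpha> c"]) (simp add: eval_rat_poly_single fun_eq_iff)

lemma rat_polynomial_of_rat: "rat_polynomial (\<lambda>y. of_rat c)"
  using rat_polynomial_monomial[of c 0] by simp

lemma rat_polynomial_0: "rat_polynomial (\<lambda>y. 0)"
  and rat_polynomial_1: "rat_polynomial (\<lambda>y. 1)"
  using rat_polynomial_of_rat[of 0] rat_polynomial_of_rat[of 1] by simp_all

lemma rat_polynomial_var: "rat_polynomial (\<lambda>y. y v)"
proof -
  have "(\<Prod>w\<in>UNIV. y w ^ Poly_Mapping.lookup (Poly_Mapping.single v 1) w) = y v" for y :: "'a \<Rightarrow> real"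
  proof -
    have "(\<Prod>w\<in>UNIV. y w ^ Poly_Mapping.lookup (Poly_Mapping.single v 1) w)
        = (\<Prod>w\<in>UNIV. if w = v then y w else 1)"
      by (rule prod.cong) (auto simp: lookup_single when_def)
    then show ?thesis by simp
  qed
  then show ?thesis
    using rat_polynomial_monomial[of 1 "Poly_Mapping.single v 1"] by simp
qed

lemma rat_polynomial_add:
  assumes "rat_polynomial f" "rat_polynomial g"
  shows "rat_polynomial (\<lambda>y. f y + g y)"
proof -
  obtain P Q where "f = eval_rat_poly P" "g = eval_rat_poly Q"
    using assms unfolding rat_polynomial_def by blast
  then have "(\<lambda>y. f y + g y) = eval_rat_poly (P + Q)"
    by (simp add: eval_rat_poly_add fun_eq_iff)
  then show ?thesis unfolding rat_polynomial_def by blast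
qed

lemma rat_polynomial_sum:
  assumes "\<And>i. i \<in> I \<Longrightarrow> rat_polynomial (f i)"
  shows "rat_polynomial (\<lambda>y. \<Sum>i\<in>I. f i y)"
  using assms
  by (induction I rule: infinite_finite_induct) (auto simp: rat_polynomial_0 rat_polynomial_add)

lemma rat_polynomial_mult:
  assumes "rat_polynomial f" "rat_polynomial g"
  shows "rat_polynomial (\<lambda>y. f y * g y)"
proof -
  obtain P Q where PQ: "f = eval_rat_poly P" "g = eval_rat_poly Q"
    using assms unfolding rat_polynomial_def by blast
  let ?m = "\<lambda>\<alpha> y. \<Prod>v\<in>UNIV. y v ^ Poly_Mapping.lookup \<alpha> v"
  have m: "?m (\<alpha> + \<beta>) y = ?m \<alpha> y * ?m \<beta> y" for \<alpha> \<beta> :: "'a \<Rightarrow>\<^sub>0 nat" and y :: "'a \<Rightarrow> real"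
    by (simp add: lookup_add power_add prod.distrib)
  have "f y * g y = (\<Sum>\<alpha>\<in>Poly_Mapping.keys P. \<Sum>\<beta>\<in>Poly_Mapping.keys Q.
      of_rat (Poly_Mapping.lookup P \<alpha> * Poly_Mapping.lookup Q \<beta>) * ?m (\<alpha> + \<beta>) y)" for y
    unfolding PQ eval_rat_poly_def sum_product m by (simp add: of_rat_mult mult_ac)
  then show ?thesis
    by (simp only:) (intro rat_polynomial_sum rat_polynomial_monomial)
qed

lemma rat_polynomial_diff:
  assumes "rat_polynomial f" "rat_polynomial g"
  shows "rat_polynomial (\<lambda>y. f y - g y)"
  using rat_polynomial_add[OF assms(1) rat_polynomial_mult[OF rat_polynomial_of_rat[of "-1"] assms(2)]]
  by simp

lemma rat_polynomial_prod:
  assumes "\<And>i. i \<in> I \<Longrightarrow> rat_polynomial (f i)"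
  shows "rat_polynomial (\<lambda>y. \<Prod>i\<in>I. f i y)"
  using assms
  by (induction I rule: infinite_finite_induct) (auto simp: rat_polynomial_1 rat_polynomial_mult)

lemma rat_polynomial_det:
  fixes M :: "('v::finite \<Rightarrow> real) \<Rightarrow> real^'a^'a"
  assumes "\<And>i j. rat_polynomial (\<lambda>y. M y $ i $ j)"
  shows "rat_polynomial (\<lambda>y. det (M y))"
proof -
  have "rat_polynomial (\<lambda>y. of_int (sign p))" for p :: "'a \<Rightarrow> 'a"
    using rat_polynomial_of_rat[of "of_int (sign p)"] by simp
  then show ?thesis
    unfolding det_def
    by (intro rat_polynomial_sum rat_polynomial_mult rat_polynomial_prod assms)
qed

text \<open>The conclusion is that the function vanishes, not that a polynomial representing it
  does, so determinants can be treated as functions and the polynomial behind them stays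
  anonymous.\<close>

definition generic_point :: "real^'a \<Rightarrow> bool" where
  "generic_point p \<longleftrightarrow>
     (\<forall>f. rat_polynomial f \<longrightarrow> f (\<lambda>v. p $ v) = 0 \<longrightarrow> (\<forall>y. f y = 0))"

lemma generic_imp_generic_point:
  assumes "generic p"
  shows "generic_point (\<chi> v. p $ fst v $ snd v)"
  unfolding generic_point_def
proof (intro allI impI)
  fix f and y :: "'b \<times> 'a \<Rightarrow> real"
  assume f: "rat_polynomial f" "f (\<lambda>v. (\<chi> v. p $ fst v $ snd v) $ v) = 0"
  obtain P where P: "f = eval_rat_poly P"
    using f(1) unfolding rat_polynomial_def by blast
  have "P = 0"
    using assms f(2) unfolding generic_def P by auto
  then show "f y = 0"
    by (simp add: P eval_rat_poly_def)
qed

text \<open>A maximal minor that does not vanish at \<^term>\<open>y\<close>, bordered by unit vectors to a square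
  determinant, does not vanish at a generic point.\<close>

lemma rank_le_rank_generic_point:
  fixes A :: "real^'a \<Rightarrow> real^'a^'b"
  assumes p: "generic_point p"
    and A: "\<And>i j. rat_polynomial (\<lambda>y. A (\<chi> v. y v) $ i $ j)"
  shows "rank (A y) \<le> rank (A p)"
proof -
  obtain B0 where B0: "B0 \<subseteq> rows (A y)" "independent B0" "rows (A y) \<subseteq> span B0"
    using maximal_independent_subset by blast
  obtain B where B: "B0 \<subseteq> B" "B \<subseteq> B0 \<union> Basis" "independent B" "B0 \<union> Basis \<subseteq> span B"
    using maximal_independent_subset_extend[of B0 "B0 \<union> Basis"] B0(2) by blast
  have "span B = UNIV"
    using B(4) span_mono[of Basis "span B"] by (auto simp: span_span)
  then have cB: "card B = CARD('a)"
    using B(3) by (metis dim_UNIV dim_span dim_eq_card_independent DIM_cart DIM_real mult.right_neutral)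
  have fB: "finite B"
    using B(3) independent_imp_finite by blast
  obtain h where h: "bij_betw h (UNIV :: 'a set) B"
    using finite_same_card_bij[of "UNIV :: 'a set" B] fB cB by auto
  have "\<exists>w. \<forall>b\<in>B0. row (w b) (A y) = b"
    using B0(1) by (intro bchoice ballI) (auto simp: rows_def)
  then obtain w where w: "\<And>b. b \<in> B0 \<Longrightarrow> row (w b) (A y) = b" by blast
  define G where "G z = (\<chi> j. if h j \<in> B0 then A z $ w (h j) else h j)" for z
  have Grow: "row j (G z) = (if h j \<in> B0 then row (w (h j)) (A z) else h j)" for j z
    by (simp add: G_def row_def vec_eq_iff)
  have "rows (G y) = B"
    using h by (auto simp: rows_def Grow w bij_betw_def)
  then have "rank (G y) = CARD('a)"
    using B(3) cB by (simp add: row_rank_def dim_eq_card_independent)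
  then have dety: "det (G y) \<noteq> 0"
    by (simp add: det_eq_0_rank)
  have "rat_polynomial (\<lambda>y. G (\<chi> v. y v) $ i $ j)" for i j
  proof (cases "h i \<in> B0")
    case True
    then show ?thesis using A by (simp add: G_def)
  next
    case False
    then have "h i \<in> Basis"
      using B(2) h by (auto simp: bij_betw_def)
    then obtain k where "h i = axis k 1"
      by (auto simp: Basis_vec_def)
    then show ?thesis
      using False by (simp add: G_def axis_def rat_polynomial_0 rat_polynomial_1)
  qed
  then have "rat_polynomial (\<lambda>y. det (G (\<chi> v. y v)))"
    by (rule rat_polynomial_det)
  then have detp: "det (G p) \<noteq> 0"
    using p dety unfolding generic_point_def by (metis (lifting) vec_nth_inverse vec_lambda_eta)
  have indp: "independent (rows (G p))"
    using detp det_dependent_rows dependent_vec_eq by blast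
  let ?J = "{j. h j \<in> B0}"
  \<comment> \<open>\<open>rows\<close> is a set, so its independence alone would allow several
    chosen rows to coincide and the count to drop; equal rows would make the determinant
    zero.\<close>
  have inj: "inj_on (\<lambda>j. row j (G p)) ?J"
    using detp det_identical_rows by (metis (mono_tags, lifting) inj_onI)
  have "card B0 = card ?J"
  proof -
    have "h ` ?J = B0" using h B(1) by (auto simp: bij_betw_def)
    moreover have "inj_on h ?J" using h by (auto simp: bij_betw_def intro: inj_on_subset)
    ultimately show ?thesis by (metis card_image)
  qed
  also have "\<dots> = card ((\<lambda>j. row j (G p)) ` ?J)"
    by (simp add: card_image inj)
  also have "\<dots> \<le> dim (rows (A p))"
  proof (rule independent_card_le_dim)
    show "(\<lambda>j. row j (G p)) ` ?J \<subseteq> rows (A p)"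
      by (auto simp: Grow rows_def)
    show "independent ((\<lambda>j. row j (G p)) ` ?J)"
      by (rule independent_mono[OF indp]) (auto simp: rows_def)
  qed
  finally have "card B0 \<le> rank (A p)"
    by (simp add: row_rank_def)
  moreover have "rank (A y) = card B0"
    using B0 by (simp add: row_rank_def dim_unique)
  ultimately show ?thesis by simp
qed

subsection \<open>Curves in the fibres of a map of constant rank\<close>

lemma dim_kernel_matrix:
  fixes A :: "real^'a^'b"
  shows "dim {v. A *v v = 0} + rank A = CARD('a)"
proof -
  have "{v. A *v v = 0} = {v \<in> UNIV. \<forall>u\<in>span (rows A). orthogonal u v}"
  proof -
    have "A *v v = 0 \<longleftrightarrow> (\<forall>u\<in>rows A. orthogonal v u)" for v
    proof -
      have "row i A = A $ i" for i by (simp add: row_def vec_eq_iff)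
      then show ?thesis
        by (auto simp: rows_def orthogonal_def vec_eq_iff[of "A *v v"] matrix_vector_mul_component
            inner_commute)
    qed
    then show ?thesis
      by (auto simp: orthogonal_commute intro: orthogonal_to_span span_base)
  qed
  then have "dim {v. A *v v = 0} + dim (span (rows A)) = dim (UNIV :: (real^'a) set)"
    using dim_subspace_orthogonal_to_vectors[of "span (rows A)" UNIV] by simp
  then show ?thesis
    by (simp add: row_rank_def)
qed

lemma inner_transpose_mult:
  fixes M :: "real^'a^'b"
  shows "(transpose M *v u) \<bullet> v = u \<bullet> (M *v v)"
  by (metis dot_lmul_matrix transpose_matrix_vector)

lemma subspace_kernel_matrix: "subspace {v. (A :: real^'a^'b) *v v = 0}"
  by (auto simp: subspace_def matrix_vector_right_distrib matrix_vector_mult_scaleR)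

text \<open>With \<open>P\<close> a projection onto the kernel of the Jacobian \<open>M\<close> at \<open>p\<close>, the map
  \<open>y \<mapsto> M\<^sup>T f(y) + P y\<close> is a local diffeomorphism at \<open>p\<close>; the curve is the preimage of a straight
  line in direction \<open>q\<close>.  Maximality of the rank forces \<open>M\<^sup>T\<close> to be injective on the ranges of the
  Jacobians near \<open>p\<close>.\<close>

lemma maximal_rank_fibre_curve:
  fixes f :: "real^'a \<Rightarrow> real^'b" and A :: "real^'a \<Rightarrow> real^'a^'b"
  assumes der: "\<And>y. (f has_derivative (\<lambda>h. A y *v h)) (at y)"
    and cont: "continuous_on UNIV A"
    and rank: "\<And>y. rank (A y) \<le> rank (A p)"
    and q: "A p *v q = 0"
  obtains c \<delta> where "\<delta> > 0" "c 0 = p" "(c has_vector_derivative q) (at 0)"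
    "\<And>s. \<bar>s\<bar> < \<delta> \<Longrightarrow> f (c s) = f p"
proof -
  define M where "M = A p"
  define K where "K = {v. M *v v = 0}"
  have subK: "subspace K"
    unfolding K_def by (rule subspace_kernel_matrix)
  \<comment> \<open>Any linear left inverse of the inclusion of \<open>K\<close> serves;
    \<open>P\<close> need not be the orthogonal projection.\<close>
  obtain P where P: "range P \<subseteq> K" "linear P" "\<And>v. v \<in> K \<Longrightarrow> P v = v"
    using linear_exists_left_inverse_on[OF linear_id subK inj_on_id] by auto
  have dimK: "dim K + rank M = CARD('a)"
    unfolding K_def by (rule dim_kernel_matrix)
  have qK: "q \<in> K"
    using q by (simp add: K_def M_def)
  define G where "G y = transpose M ** A y + matrix P" for y
  have G: "G y *v h = transpose M *v (A y *v h) + P h" for y h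
    using P(2) by (simp add: G_def matrix_vector_mult_add_rdistrib matrix_vector_mul_assoc matrix_works)
  define f' where "f' y = Blinfun ((*v) (G y))" for y
  have f': "blinfun_apply (f' y) = (*v) (G y)" for y
    unfolding f'_def by (rule bounded_linear_Blinfun_apply) simp
  define \<Phi> where "\<Phi> y = transpose M *v f y + P y" for y
  have blP: "bounded_linear P"
    using P(2) linear_conv_bounded_linear by blast
  have d\<Phi>: "(\<Phi> has_derivative blinfun_apply (f' y)) (at y)" for y
    unfolding \<Phi>_def f' G
    by (intro has_derivative_add bounded_linear.has_derivative[OF blP] has_derivative_ident
        bounded_linear.has_derivative[OF matrix_vector_mul_bounded_linear] der)
  have "linear (\<lambda>X :: real^'a^'a. Blinfun ((*v) X))"
    by (rule linearI; rule blinfun_eqI)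
      (simp_all add: bounded_linear_Blinfun_apply blinfun.add_left blinfun.scaleR_left
        matrix_vector_mult_add_rdistrib scaleR_matrix_vector_assoc)
  then have contB: "continuous_on UNIV (\<lambda>X :: real^'a^'a. Blinfun ((*v) X))"
    using linear_continuous_on linear_conv_bounded_linear by blast
  have contG: "continuous_on UNIV G"
  proof -
    have "linear (\<lambda>X :: real^'a^'b. transpose M ** X)"
      by (rule linearI)
        (simp_all add: vec_eq_iff matrix_matrix_mult_def sum_distrib_left sum.distrib algebra_simps)
    then have "continuous_on UNIV (\<lambda>X :: real^'a^'b. transpose M ** X)"
      using linear_continuous_on linear_conv_bounded_linear by blast
    then have "continuous_on UNIV (\<lambda>y. transpose M ** A y)"
      using cont continuous_on_compose2 by blast
    then show ?thesis
      unfolding G_def by (intro continuous_intros)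
  qed
  have contf': "continuous_on UNIV f'"
    unfolding f'_def by (rule continuous_on_compose2[OF contB contG subset_UNIV])
  have injG: "v = 0" if "G p *v v = 0" for v
  proof -
    have e: "transpose M *v (M *v v) + P v = 0"
      using that by (simp add: G M_def)
    have PK: "M *v P v = 0" using P(1) by (auto simp: K_def)
    \<comment> \<open>The range of \<open>transpose M\<close> is orthogonal to the kernel
      \<open>K\<close> of \<open>M\<close>, so the two summands of \<open>G p *v v\<close> vanish
      separately.\<close>
    have "(transpose M *v (M *v v) + P v) \<bullet> P v = P v \<bullet> P v"
      by (simp only: inner_add_left inner_transpose_mult PK inner_zero_right add_0)
    then have "P v = 0" using e by simp
    then have "transpose M *v (M *v v) = 0" using e by simp
    then have "(M *v v) \<bullet> (M *v v) = 0"
      by (metis inner_transpose_mult inner_zero_left)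
    then have "v \<in> K" by (simp add: K_def)
    then show "v = 0" using P(3) \<open>P v = 0\<close> by simp
  qed
  obtain N where N: "N ** G p = mat 1"
    using injG matrix_left_invertible_ker[of "G p"] by blast
  have invf: "Blinfun ((*v) N) o\<^sub>L f' p = id_blinfun"
    by (rule blinfun_eqI) (simp add: f' bounded_linear_Blinfun_apply matrix_vector_mul_assoc N)
  obtain U' V g g' where UV: "open U'" "p \<in> U'" "open V" "\<Phi> p \<in> V" "homeomorphism U' V \<Phi> g"
    and dg: "\<And>y. y \<in> V \<Longrightarrow> (g has_derivative (g' y)) (at y)"
    and g': "\<And>y. y \<in> V \<Longrightarrow> g' y = inv (blinfun_apply (f' (g y)))"
    and bij: "\<And>y. y \<in> V \<Longrightarrow> bij (blinfun_apply (f' (g y)))"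
    using inverse_function_theorem[OF open_UNIV d\<Phi> contf' UNIV_I invf] by metis
  have gp: "g (\<Phi> p) = p"
    using UV by (simp add: homeomorphism_def)
  \<comment> \<open>Maximality of the rank is used here. \<open>W\<close> meets the kernel of
    \<open>P\<close> only in 0, because \<open>G (g z)\<close> is injective, so dim W \<le> dim K.
    Since the rank of \<open>Y\<close> is at most that of \<open>M\<close>, dim K is at most the
    dimension of the kernel of \<open>Y\<close>, which itself lies in \<open>W\<close>. The two
    kernels thus agree.\<close>
  have key: "A (g z) *v v = 0" if "z \<in> V" "G (g z) *v v = q" for z v
  proof -
    define Y where "Y = A (g z)"
    define W where "W = {u. (transpose M ** Y) *v u = 0}"
    have injGz: "u = 0" if "G (g z) *v u = 0" for u
    proof -
      have "inj ((*v) (G (g z)))" using bij[OF \<open>z \<in> V\<close>] f' bij_is_inj by metis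
      then show ?thesis using that by (metis injD matrix_vector_mult_0_right)
    qed
    have "inj_on P W"
    proof (rule linear_inj_on_iff_eq_0[THEN iffD2, OF P(2)])
      show "subspace W" unfolding W_def by (rule subspace_kernel_matrix)
      have "G (g z) *v u = (transpose M ** Y) *v u + P u" for u
        unfolding G Y_def matrix_vector_mul_assoc ..
      then show "\<forall>u\<in>W. P u = 0 \<longrightarrow> u = 0"
        using injGz unfolding W_def by (metis (lifting) mem_Collect_eq add_0)
    qed
    have "dim W = dim (P ` W)"
      using dim_image_eq[OF P(2)] \<open>inj_on P W\<close>
      by (metis W_def span_eq_iff subspace_kernel_matrix)
    also have "\<dots> \<le> dim K"
      using P(1) by (intro dim_subset) auto
    also have "dim K \<le> dim {u. Y *v u = 0}"
      using dimK dim_kernel_matrix[of Y] rank[of "g z"] by (simp add: M_def Y_def)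
    finally have "dim W \<le> dim {u. Y *v u = 0}" .
    moreover have "{u. Y *v u = 0} \<subseteq> W"
      by (auto simp: W_def simp flip: matrix_vector_mul_assoc)
    ultimately have WY: "{u. Y *v u = 0} = W"
      using subspace_dim_equal[of "{u. Y *v u = 0}" W]
      by (simp add: subspace_kernel_matrix W_def)
    \<comment> \<open>\<open>w\<close> lies in the range of \<open>transpose M\<close> and, being
      \<open>q - P v\<close>, also in the kernel of \<open>M\<close>; these spaces are orthogonal,
      so \<open>w\<close> is zero.\<close>
    define w where "w = transpose M *v (Y *v v)"
    have "w = q - P v"
      using that(2) unfolding G Y_def w_def by (simp add: algebra_simps)
    then have "w \<in> K"
      using qK P(1) subspace_diff[OF subK] by (metis rangeI subsetD)
    then have "w \<bullet> w = 0"
      unfolding w_def inner_transpose_mult by (simp add: K_def w_def)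
    then have "v \<in> W"
      by (simp add: W_def w_def matrix_vector_mul_assoc)
    then show ?thesis using WY Y_def by blast
  qed
  obtain e where e: "e > 0" "ball (\<Phi> p) e \<subseteq> V"
    using UV(3,4) open_contains_ball by blast
  \<comment> \<open>The summand 1 covers the case \<open>q = 0\<close>.\<close>
  define \<delta> where "\<delta> = e / (norm q + 1)"
  have \<delta>: "\<delta> > 0" using e by (simp add: \<delta>_def add_nonneg_pos)
  have inV: "\<Phi> p + s *\<^sub>R q \<in> V" if "\<bar>s\<bar> < \<delta>" for s
  proof -
    have "norm (s *\<^sub>R q) \<le> \<bar>s\<bar> * (norm q + 1)"
      by (simp add: mult_left_mono)
    also have "\<dots> < e"
      using that by (simp add: \<delta>_def pos_less_divide_eq add_nonneg_pos)
    finally have "\<Phi> p + s *\<^sub>R q \<in> ball (\<Phi> p) e" by (simp add: dist_norm)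
    then show ?thesis using e by blast
  qed
  define c where "c s = g (\<Phi> p + s *\<^sub>R q)" for s
  have dc: "(c has_vector_derivative g' (\<Phi> p + s *\<^sub>R q) q) (at s)" if "\<bar>s\<bar> < \<delta>" for s
  proof -
    have "((\<lambda>s. \<Phi> p + s *\<^sub>R q) has_derivative (\<lambda>t. t *\<^sub>R q)) (at s)"
      by (auto intro!: derivative_eq_intros)
    from has_derivative_compose[OF this dg[OF inV[OF that]]]
    have "(c has_derivative (\<lambda>t. g' (\<Phi> p + s *\<^sub>R q) (t *\<^sub>R q))) (at s)"
      unfolding c_def[abs_def] .
    moreover have "linear (g' (\<Phi> p + s *\<^sub>R q))"
      using dg[OF inV[OF that]] has_derivative_linear by blast
    ultimately show ?thesis
      by (simp add: has_vector_derivative_def linear_cmul)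
  qed
  have Gg': "G (c s) *v g' (\<Phi> p + s *\<^sub>R q) q = q" if "\<bar>s\<bar> < \<delta>" for s
    using bij[OF inV[OF that]] by (simp add: g'[OF inV[OF that]] c_def f' bij_is_surj surj_f_inv_f)
  \<comment> \<open>The velocity of the curve is the vector that the derivative of
    \<open>\<Phi>\<close> sends to \<open>q\<close>, which is the situation of
    \<open>key\<close>.\<close>
  have zero: "A (c s) *v g' (\<Phi> p + s *\<^sub>R q) q = 0" if "\<bar>s\<bar> < \<delta>" for s
    using key[OF inV[OF that]] Gg'[OF that] unfolding c_def by blast
  have fc: "((\<lambda>s. f (c s)) has_derivative (\<lambda>t. 0)) (at s)" if "\<bar>s\<bar> < \<delta>" for s
  proof -
    have "((\<lambda>s. f (c s)) has_derivative (\<lambda>t. A (c s) *v (t *\<^sub>R g' (\<Phi> p + s *\<^sub>R q) q))) (at s)"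
      using has_derivative_compose[OF dc[OF that, unfolded has_vector_derivative_def] der] .
    then show ?thesis
      by (simp add: matrix_vector_mult_scaleR zero[OF that])
  qed
  have c0: "c 0 = p" by (simp add: c_def gp)
  have const: "f (c s) = f p" if "\<bar>s\<bar> < \<delta>" for s
  proof -
    have "((\<lambda>s. f (c s)) has_derivative (\<lambda>h. 0)) (at t within {-\<delta><..<\<delta>})"
      if "t \<in> {-\<delta><..<\<delta>}" for t
      by (rule has_derivative_at_withinI[OF fc]) (use that in auto)
    then have "f (c s) = f (c 0)"
      by (rule has_derivative_zero_unique[OF convex_real_interval(8)]) (use that \<delta> in auto)
    then show ?thesis by (simp add: c0)
  qed
  have "g' (\<Phi> p) q = q"
  proof -
    have "G p *v q = q"
      using qK P(3) by (simp add: G K_def M_def)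
    then have "G p *v (g' (\<Phi> p) q - q) = 0"
      using Gg'[of 0] \<delta> c0 by (simp add: matrix_vector_mult_diff_distrib)
    then show ?thesis using injG by fastforce
  qed
  then have "(c has_vector_derivative q) (at 0)"
    using dc[of 0] \<delta> by simp
  then show thesis
    using that \<delta> c0 const by blast
qed

subsection \<open>The pseudoinverse of the graph Laplacian\<close>

lemma moore_penrose_unique:
  assumes X: "moore_penrose A X" and Y: "moore_penrose A Y"
  shows "X = Y"
proof -
  have t: "transpose (A ** X) = A ** X" "transpose (X ** A) = X ** A"
    "transpose (A ** Y) = A ** Y" "transpose (Y ** A) = Y ** A"
    and m: "A ** X ** A = A" "X ** A ** X = X" "A ** Y ** A = A" "Y ** A ** Y = Y"
    using X Y by (simp_all add: moore_penrose_def)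
  have AXY: "A ** X = A ** Y"
  proof -
    have "A ** X = transpose (A ** Y ** (A ** X))"
      using t(1) m(3) by (simp add: matrix_mul_assoc)
    also have "\<dots> = (A ** X) ** (A ** Y)"
      by (simp only: matrix_transpose_mul[of "A ** Y"] t)
    finally show ?thesis
      using m(1) by (simp add: matrix_mul_assoc)
  qed
  have XYA: "X ** A = Y ** A"
  proof -
    have "X ** A = transpose (X ** A ** (Y ** A))"
      using t(2) m(3) by (metis matrix_mul_assoc)
    also have "\<dots> = (Y ** A) ** (X ** A)"
      by (simp only: matrix_transpose_mul[of "X ** A"] t)
    finally show ?thesis
      using m(1) by (metis matrix_mul_assoc)
  qed
  have "X = X ** A ** X" using m by simp
  also have "\<dots> = Y ** (A ** Y)"
    using AXY XYA by (metis matrix_mul_assoc)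
  also have "\<dots> = Y" using m by (simp add: matrix_mul_assoc)
  finally show ?thesis .
qed

lemma pinv_eqI: "moore_penrose A X \<Longrightarrow> pinv A = X"
  unfolding pinv_def using moore_penrose_unique by blast

lemma outer_mult_vector: "outer u v *v w = (v \<bullet> w) *\<^sub>R u"
  by (simp add: outer_def vec_eq_iff matrix_vector_mult_def inner_vec_def sum_distrib_left
      sum_distrib_right mult_ac)

lemma mult_outer: "M ** outer u v = outer (M *v u) v"
  by (simp add: outer_def vec_eq_iff matrix_vector_mult_def matrix_matrix_mult_def
      sum_distrib_left sum_distrib_right mult_ac)

lemma transpose_outer: "transpose (outer u v) = outer v u"
  by (simp add: outer_def transpose_def vec_eq_iff mult.commute)

lemma matrix_add_rdistrib: "(A + B) ** C = A ** C + B ** C"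
  for A :: "real^'a^'b"
  by (simp add: vec_eq_iff matrix_matrix_mult_def sum.distrib distrib_right)

lemma matrix_diff_rdistrib: "(A - B) ** C = A ** C - B ** C"
  for A :: "real^'a^'b"
  by (simp add: vec_eq_iff matrix_matrix_mult_def sum_subtractf left_diff_distrib)

lemma matrix_diff_ldistrib: "C ** (A - B) = C ** A - C ** B"
  for A :: "real^'a^'b"
  by (simp add: vec_eq_iff matrix_matrix_mult_def sum_subtractf right_diff_distrib)

lemma sum_matrix_mult_vector: "(\<Sum>e\<in>I. M e) *v w = (\<Sum>e\<in>I. M e *v w)"
  for M :: "'e \<Rightarrow> real^'a^'b"
  by (induction I rule: infinite_finite_induct) (auto simp: matrix_vector_mult_add_rdistrib)

lemma matrix_mult_sum_right: "N ** (\<Sum>e\<in>I. M e) = (\<Sum>e\<in>I. N ** M e)"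
  for M :: "'e \<Rightarrow> real^'a^'b"
  by (induction I rule: infinite_finite_induct) (auto simp: matrix_add_ldistrib)

lemma matrix_mult_sum_left: "(\<Sum>e\<in>I. M e) ** N = (\<Sum>e\<in>I. M e ** N)"
  for M :: "'e \<Rightarrow> real^'a^'b"
  by (induction I rule: infinite_finite_induct) (auto simp: matrix_add_rdistrib)

lemma outer_mult: "outer u v ** M = outer u (transpose M *v v)"
  by (simp add: outer_def vec_eq_iff vector_matrix_mult_def matrix_matrix_mult_def
      sum_distrib_left mult_ac)

lemma edge_vec_inner: "edge_vec k i \<bullet> z = z $ Inl k - z $ Inr i"
  by (simp add: edge_vec_def inner_diff_left inner_axis')

lemma mat_L_mult: "mat_L E *v z = (\<Sum>(k, i)\<in>E. (z $ Inl k - z $ Inr i) *\<^sub>R edge_vec k i)"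
  unfolding mat_L_def sum_matrix_mult_vector
  by (rule sum.cong) (auto simp: outer_mult_vector edge_vec_inner)

lemma inner_mat_L: "y \<bullet> (mat_L E *v z) =
    (\<Sum>(k, i)\<in>E. (y $ Inl k - y $ Inr i) * (z $ Inl k - z $ Inr i))"
  unfolding mat_L_mult inner_sum_right
  by (rule sum.cong) (auto simp: inner_commute[of y] edge_vec_inner)

lemma transpose_sum: "transpose (\<Sum>e\<in>I. M e) = (\<Sum>e\<in>I. transpose (M e))"
  for M :: "'e \<Rightarrow> real^'a^'b"
  by (simp add: transpose_def vec_eq_iff sum_component)

lemma transpose_mat_L: "transpose (mat_L E) = mat_L E"
  unfolding mat_L_def transpose_sum
  by (rule sum.cong) (auto simp: transpose_outer)

text \<open>The quadratic form of the Laplacian is the sum of the squared differences along edges;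
  if it vanishes, the values agree on every edge, and paths carry the equality to all
  vertices.\<close>

lemma mat_L_kernel_constant:
  fixes E :: "('n::finite \<times> 'm::finite) set"
  assumes "graph_connected E" "mat_L E *v z = 0"
  shows "z $ u = z $ v"
proof -
  have "(\<Sum>(k, i)\<in>E. (z $ Inl k - z $ Inr i) * (z $ Inl k - z $ Inr i)) = 0"
    using assms(2) inner_mat_L[of z E z] by simp
  then have edge: "\<forall>(k, i)\<in>E. z $ Inl k = z $ Inr i"
    by (subst (asm) sum_nonneg_eq_0_iff) (auto simp: finite_subset[of E UNIV])
  have "(u, v) \<in> (graph_adj E)\<^sup>*"
    using assms(1) by (simp add: graph_connected_def)
  then show ?thesis
    by (induction rule: rtrancl_induct) (use edge in \<open>auto simp: graph_adj_def\<close>)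
qed

text \<open>The orthogonal projection onto the constant vectors, that is, onto the Laplacian kernel
  of a connected graph.\<close>

definition averaging :: "real^'a^'a" where
  "averaging = (1 / real CARD('a)) *\<^sub>R outer 1 1"

lemma averaging_mult: "averaging *v z = (\<chi> _. (\<Sum>v\<in>UNIV. z $ v) / real CARD('a))"
  for z :: "real^'a"
  by (simp add: averaging_def vec_eq_iff matrix_vector_mult_def outer_def sum_divide_distrib)

lemma averaging_const: "averaging *v (\<chi> _. a) = ((\<chi> _. a) :: real^'a)"
  by (simp add: averaging_mult vec_eq_iff)

lemma transpose_averaging: "transpose averaging = averaging"
  by (simp add: averaging_def transpose_def outer_def vec_eq_iff)

lemma mat_L_averaging: "mat_L E ** averaging = 0" "averaging ** mat_L E = 0"
proof -
  have "mat_L E *v (averaging *v z) = 0" for z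
    by (simp add: averaging_mult mat_L_mult case_prod_beta)
  then show "mat_L E ** averaging = 0"
    by (simp add: matrix_eq flip: matrix_vector_mul_assoc)
  then have "transpose (mat_L E ** averaging) = 0"
    by (simp add: transpose_def vec_eq_iff)
  then show "averaging ** mat_L E = 0"
    by (simp add: matrix_transpose_mul transpose_mat_L transpose_averaging)
qed

text \<open>Adding the projection J onto the kernel makes the Laplacian L invertible, and the
  pseudoinverse is the inverse of L + J with J subtracted again.\<close>

lemma pinv_mat_L:
  fixes E :: "('n::finite \<times> 'm::finite) set"
  assumes "graph_connected E"
  shows "pinv (mat_L E) ** mat_L E = mat 1 - averaging"
    "transpose (pinv (mat_L E)) = pinv (mat_L E)"
    "pinv (mat_L E) ** mat_L E ** pinv (mat_L E) = pinv (mat_L E)"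
proof -
  let ?L = "mat_L E" and ?J = "averaging :: real^('n + 'm)^('n + 'm)"
  have JJ: "?J ** ?J = ?J"
    by (simp add: matrix_eq averaging_mult flip: matrix_vector_mul_assoc)
  have "z = 0" if z: "(?L + ?J) *v z = 0" for z
  proof -
    have "?J *v ((?L + ?J) *v z) = 0" using z by simp
    then have J: "?J *v z = 0"
      by (simp add: matrix_vector_mul_assoc matrix_add_ldistrib mat_L_averaging JJ)
    then have "?L *v z = 0"
      using z by (simp add: matrix_vector_mult_add_rdistrib)
    then have const: "z $ u = z $ v" for u v
      using mat_L_kernel_constant assms by blast
    have "z = (\<chi> _. z $ undefined)"
      unfolding vec_eq_iff vec_lambda_beta using const by blast
    then show "z = 0"
      using J averaging_const by metis
  qed
  then obtain M where M: "M ** (?L + ?J) = mat 1" and M': "(?L + ?J) ** M = mat 1"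
    using matrix_left_invertible_ker[of "?L + ?J"] matrix_left_right_inverse by blast
  have "?J ** ((?L + ?J) ** M) = ?J" by (simp add: M')
  then have JM: "?J ** M = ?J"
    by (simp add: matrix_mul_assoc matrix_add_ldistrib mat_L_averaging JJ)
  have "(M ** (?L + ?J)) ** ?J = ?J" by (simp add: M)
  then have MJ: "M ** ?J = ?J"
    by (simp add: matrix_mul_assoc[symmetric] matrix_add_rdistrib mat_L_averaging JJ)
  define X where "X = M - ?J"
  have M2: "M ** ?L = mat 1 - ?J" "?L ** M = mat 1 - ?J"
    using M M' JM MJ by (simp_all add: matrix_add_ldistrib matrix_add_rdistrib algebra_simps)
  have XL: "X ** ?L = mat 1 - ?J" and LX: "?L ** X = mat 1 - ?J"
    by (simp_all add: X_def matrix_diff_rdistrib matrix_diff_ldistrib M2 mat_L_averaging)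
  have t: "transpose (mat 1 - ?J) = mat 1 - ?J"
  proof -
    have "transpose (A - B) = transpose A - transpose B" for A B :: "real^('n + 'm)^('n + 'm)"
      by (simp add: transpose_def vec_eq_iff)
    then show ?thesis by (simp add: transpose_averaging)
  qed
  have LXL: "?L ** X ** ?L = ?L"
    by (simp add: LX matrix_diff_rdistrib mat_L_averaging)
  have XLX: "X ** ?L ** X = X"
    by (simp add: XL matrix_diff_rdistrib) (simp add: X_def matrix_diff_ldistrib JM JJ)
  have mp: "moore_penrose ?L X"
    using XL LX LXL XLX t by (simp add: moore_penrose_def)
  have IX: "(mat 1 - ?J) ** X = X" using XLX by (simp add: XL)
  have "transpose X ** ?L = mat 1 - ?J"
    by (metis LX matrix_transpose_mul t transpose_mat_L)
  then have "transpose X ** (?L ** X) = X"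
    by (simp add: matrix_mul_assoc IX)
  moreover have "transpose X ** (mat 1 - ?J) = transpose X"
    by (metis IX matrix_transpose_mul t)
  ultimately have "transpose X = X" by (simp add: LX)
  moreover have "pinv ?L = X"
    using mp by (rule pinv_eqI)
  ultimately show "pinv ?L ** ?L = mat 1 - ?J" "transpose (pinv ?L) = pinv ?L"
    "pinv ?L ** ?L ** pinv ?L = pinv ?L"
    using XL XLX by simp_all
qed

subsection \<open>The alignment error as a sum of squared residuals\<close>

text \<open>Row \<open>a\<close> of the matrix \<open>vertex_coords E x Y\<close> holds the \<open>a\<close>-th coordinates of the optimal
  points (columns \<open>Inl k\<close>) and view translations (columns \<open>Inr i\<close>) for the stack \<open>Y\<close>; the
  residual measures the mismatch at the edge \<open>(k, i)\<close>.\<close>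

definition vertex_coords :: "('n::finite \<times> 'm::finite) set \<Rightarrow> ('n \<Rightarrow> 'm \<Rightarrow> real^'d)
    \<Rightarrow> real^'d^'d^'m \<Rightarrow> real^('n + 'm)^'d" where
  "vertex_coords E x Y = transpose (vstack Y) ** mat_B E x ** pinv (mat_L E)"

definition residual :: "('n::finite \<times> 'm::finite) set \<Rightarrow> ('n \<Rightarrow> 'm \<Rightarrow> real^'d)
    \<Rightarrow> real^'d^'d^'m \<Rightarrow> real^'d^'m^'n" where
  "residual E x Y = (\<chi> k i. if (k, i) \<in> E
     then transpose (Y $ i) *v x k i -
       (\<chi> a. vertex_coords E x Y $ a $ Inl k - vertex_coords E x Y $ a $ Inr i)
     else 0)"

lemma vstack_view_block: "transpose (vstack Y) ** view_block i = transpose (Y $ i)"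
proof -
  have "(\<Sum>p\<in>UNIV. Y $ fst p $ snd p $ a * ((if fst p = i then 1 else 0) * (if snd p = b then 1 else 0)))
      = Y $ i $ b $ a" for a b
  proof -
    have "(\<Sum>p\<in>UNIV. Y $ fst p $ snd p $ a * ((if fst p = i then 1 else 0) * (if snd p = b then 1 else 0)))
      = (\<Sum>p\<in>UNIV. if p = (i, b) then Y $ i $ b $ a else 0)"
      by (rule sum.cong) (auto simp: prod_eq_iff)
    then show ?thesis by simp
  qed
  then show ?thesis
    by (simp add: vec_eq_iff transpose_def matrix_matrix_mult_def vstack_def view_block_def
        axis_def mat_def)
qed

lemma vstack_mat_B: "transpose (vstack Y) ** mat_B E x =
    (\<Sum>(k, i)\<in>E. outer (transpose (Y $ i) *v x k i) (edge_vec k i))"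
  unfolding mat_B_def matrix_mult_sum_right
proof (rule sum.cong[OF refl], clarify)
  fix k i
  show "transpose (vstack Y) ** (view_block i ** outer (x k i) (edge_vec k i)) =
      outer (transpose (Y $ i) *v x k i) (edge_vec k i)"
    by (subst matrix_mul_assoc) (simp only: vstack_view_block mult_outer)
qed

lemma vstack_mat_D: "transpose (vstack Y) ** mat_D E x ** vstack Y =
    (\<Sum>(k, i)\<in>E. outer (transpose (Y $ i) *v x k i) (transpose (Y $ i) *v x k i))"
proof -
  have *: "transpose (view_block i) ** vstack Y = Y $ i" for i
    by (metis vstack_view_block matrix_transpose_mul transpose_transpose)
  show ?thesis
    unfolding mat_D_def matrix_mult_sum_right matrix_mult_sum_left
  proof (rule sum.cong[OF refl], clarify)
    fix k i
    have "transpose (vstack Y) ** (view_block i ** outer (x k i) (x k i) ** transpose (view_block i)) ** vstack Y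
      = (transpose (vstack Y) ** view_block i) ** outer (x k i) (x k i) ** (transpose (view_block i) ** vstack Y)"
      by (simp only: matrix_mul_assoc)
    then show "transpose (vstack Y) ** (view_block i ** outer (x k i) (x k i) ** transpose (view_block i)) ** vstack Y
      = outer (transpose (Y $ i) *v x k i) (transpose (Y $ i) *v x k i)"
      by (simp only: vstack_view_block * mult_outer outer_mult) 
  qed
qed

lemma vstack_mat_B_row: "(transpose (vstack Y) ** mat_B E x) $ a =
    (\<Sum>(k, i)\<in>E. (transpose (Y $ i) *v x k i) $ a *\<^sub>R edge_vec k i)"
  unfolding vstack_mat_B sum_component
  by (rule sum.cong) (auto simp: outer_def vec_eq_iff)

lemma matrix_mult_row: "(M ** N) $ a = transpose N *v (M $ a)"
  for M :: "real^'a^'b"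
  by (simp add: vec_eq_iff matrix_matrix_mult_def vector_matrix_mult_def mult.commute)

lemma trace_outer_self: "trace (outer u u) = u \<bullet> u"
  by (simp add: trace_def outer_def inner_vec_def)

text \<open>In each coordinate, with right-hand side b and z the pseudoinverse applied to b, the
  squared residual expands into |u|^2 - 2 b.z + z.Lz. The last term equals b.z, because z is fixed
  by the pseudoinverse times L. What remains is the trace that defines the error:
  \<open>mat_C\<close> is what least squares leaves after the points and translations are
  eliminated.\<close>

lemma align_error_eq_residual:
  fixes x :: "'n::finite \<Rightarrow> 'm::finite \<Rightarrow> real^'d"
  assumes "graph_connected E"
  shows "align_error E x Y = (norm (residual E x Y))\<^sup>2"
proof -
  note pinv = pinv_mat_L[OF assms]
  let ?L = "mat_L E" and ?P = "pinv (mat_L E)" and ?V = "vstack Y"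
  define b where "b = transpose ?V ** mat_B E x"
  define u where "u k i = transpose (Y $ i) *v x k i" for k i
  define z where "z a = vertex_coords E x Y $ a" for a
  have z: "z a = ?P *v (b $ a)" for a
    by (simp add: z_def vertex_coords_def matrix_mult_row pinv b_def)
  have b: "b $ a \<bullet> w = (\<Sum>(k, i)\<in>E. u k i $ a * (w $ Inl k - w $ Inr i))" for a w
    unfolding b_def vstack_mat_B_row u_def inner_sum_left
    by (rule sum.cong) (auto simp: edge_vec_inner)
  have "align_error E x Y = trace (transpose ?V ** mat_C E x ** ?V)"
    unfolding align_error_def by (subst trace_mul_sym) (simp add: matrix_mul_assoc)
  also have "transpose ?V ** mat_C E x ** ?V =
      transpose ?V ** mat_D E x ** ?V - b ** ?P ** transpose b"
    by (simp add: mat_C_def matrix_diff_ldistrib matrix_diff_rdistrib b_def matrix_transpose_mul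
        matrix_mul_assoc)
  also have "trace \<dots> = trace (transpose ?V ** mat_D E x ** ?V) - trace (b ** ?P ** transpose b)"
    by (rule trace_sub)
  also have "trace (transpose ?V ** mat_D E x ** ?V) = (\<Sum>(k, i)\<in>E. u k i \<bullet> u k i)"
  proof -
    have t0: "trace (0 :: real^'d^'d) = 0" by (simp add: trace_def)
    have "trace (\<Sum>e\<in>I. M e) = (\<Sum>e\<in>I. trace (M e))" for I :: "('n \<times> 'm) set" and M :: "'n \<times> 'm \<Rightarrow> real^'d^'d"
      by (induction I rule: infinite_finite_induct) (auto simp: trace_add t0)
    then show ?thesis
      unfolding vstack_mat_D u_def by (auto intro!: sum.cong simp: trace_outer_self)
  qed
  also have "trace (b ** ?P ** transpose b) = (\<Sum>a\<in>UNIV. b $ a \<bullet> z a)"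
    unfolding trace_def
  proof (rule sum.cong[OF refl])
    fix a
    have "(b ** ?P ** transpose b) $ a $ a = (b ** ?P) $ a \<bullet> b $ a"
      by (simp add: matrix_mult_row[of "b ** ?P"] matrix_vector_mul_component inner_commute)
    also have "\<dots> = z a \<bullet> b $ a"
      by (simp add: matrix_mult_row pinv z)
    finally show "(b ** ?P ** transpose b) $ a $ a = b $ a \<bullet> z a"
      by (simp add: inner_commute)
  qed
  finally have err: "align_error E x Y = (\<Sum>(k, i)\<in>E. u k i \<bullet> u k i) - (\<Sum>a\<in>UNIV. b $ a \<bullet> z a)" .
  have zLz: "(\<Sum>(k, i)\<in>E. (z a $ Inl k - z a $ Inr i)\<^sup>2) = b $ a \<bullet> z a" for a
  proof -
    have "(\<Sum>(k, i)\<in>E. (z a $ Inl k - z a $ Inr i)\<^sup>2) = z a \<bullet> (?L *v z a)"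
      unfolding inner_mat_L power2_eq_square ..
    also have "\<dots> = (transpose ?P *v b $ a) \<bullet> (?L *v z a)"
      by (simp add: z pinv)
    also have "\<dots> = b $ a \<bullet> ((?P ** ?L ** ?P) *v b $ a)"
      unfolding transpose_matrix_vector dot_lmul_matrix z by (simp add: matrix_vector_mul_assoc matrix_mul_assoc)
    finally show ?thesis by (simp only: pinv(3) z)
  qed
  have "(norm (residual E x Y))\<^sup>2 = (\<Sum>(k, i)\<in>UNIV. residual E x Y $ k $ i \<bullet> residual E x Y $ k $ i)"
    by (simp add: power2_norm_eq_inner inner_vec_def[of "residual E x Y"] inner_vec_def[of "residual E x Y $ _"]
        sum.cartesian_product)
  also have "\<dots> = (\<Sum>(k, i)\<in>E. \<Sum>a\<in>UNIV. (u k i $ a - (z a $ Inl k - z a $ Inr i))\<^sup>2)"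
    by (rule sum.mono_neutral_cong_right)
      (auto simp: residual_def u_def z_def inner_vec_def power2_eq_square)
  also have "\<dots> = (\<Sum>a\<in>UNIV. \<Sum>(k, i)\<in>E. (u k i $ a)\<^sup>2 - 2 * (u k i $ a * (z a $ Inl k - z a $ Inr i))
       + (z a $ Inl k - z a $ Inr i)\<^sup>2)"
    unfolding case_prod_beta by (subst sum.swap) (simp add: power2_eq_square algebra_simps)
  also have "\<dots> = (\<Sum>a\<in>UNIV. (\<Sum>(k, i)\<in>E. (u k i $ a)\<^sup>2) - 2 * (b $ a \<bullet> z a) + b $ a \<bullet> z a)"
  proof (rule sum.cong[OF refl])
    fix a
    have "(\<Sum>(k, i)\<in>E. (u k i $ a)\<^sup>2 - 2 * (u k i $ a * (z a $ Inl k - z a $ Inr i))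
        + (z a $ Inl k - z a $ Inr i)\<^sup>2) =
      (\<Sum>(k, i)\<in>E. (u k i $ a)\<^sup>2) - 2 * (\<Sum>(k, i)\<in>E. u k i $ a * (z a $ Inl k - z a $ Inr i))
        + (\<Sum>(k, i)\<in>E. (z a $ Inl k - z a $ Inr i)\<^sup>2)"
      by (simp add: case_prod_beta sum.distrib sum_subtractf sum_distrib_left)
    then show "(\<Sum>(k, i)\<in>E. (u k i $ a)\<^sup>2 - 2 * (u k i $ a * (z a $ Inl k - z a $ Inr i))
        + (z a $ Inl k - z a $ Inr i)\<^sup>2) =
      (\<Sum>(k, i)\<in>E. (u k i $ a)\<^sup>2) - 2 * (b $ a \<bullet> z a) + b $ a \<bullet> z a"
      by (simp only: zLz b)
  qed
  also have "\<dots> = (\<Sum>a\<in>UNIV. \<Sum>(k, i)\<in>E. (u k i $ a)\<^sup>2) - (\<Sum>a\<in>UNIV. b $ a \<bullet> z a)"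
    by (simp add: sum_subtractf)
  also have "(\<Sum>a\<in>UNIV. \<Sum>(k, i)\<in>E. (u k i $ a)\<^sup>2) = (\<Sum>(k, i)\<in>E. u k i \<bullet> u k i)"
    by (subst sum.swap) (simp add: inner_vec_def power2_eq_square case_prod_beta)
  finally show ?thesis by (simp add: err)
qed

section \<open>Linearity and equivariance of vertex coordinates, residual and realization\<close>

lemma scaleR_matrix_mult: "(c *\<^sub>R M) ** N = c *\<^sub>R (M ** N)" for M :: "real^'a^'b"
  by (simp add: vec_eq_iff matrix_matrix_mult_def sum_distrib_left mult_ac)

lemma mult_point_columns: "M ** point_columns N = point_columns (M ** N)"
  by (simp add: vec_eq_iff matrix_matrix_mult_def point_columns_def)

lemma column_diff_mult:
  "(\<chi> a. (M ** N) $ a $ v - (M ** N) $ a $ w) = M *v (\<chi> a. N $ a $ v - N $ a $ w)"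
  for M :: "real^'a^'b"
  by (simp add: vec_eq_iff matrix_matrix_mult_def matrix_vector_mult_def sum_subtractf
      right_diff_distrib)

lemma vstack_add: "vstack (X + Y) = vstack X + vstack Y"
  and vstack_scaleR: "vstack (c *\<^sub>R X) = c *\<^sub>R vstack X"
  by (simp_all add: vstack_def vec_eq_iff)

lemma vstack_right_mult: "vstack (right_mult Y Q) = vstack Y ** Q"
  by (simp add: vstack_def right_mult_def vec_eq_iff matrix_matrix_mult_def)

lemma vertex_coords_add: "vertex_coords E x (X + Y) = vertex_coords E x X + vertex_coords E x Y"
proof -
  have "transpose (vstack X + vstack Y) = transpose (vstack X) + transpose (vstack Y)"
    by (simp add: transpose_def vec_eq_iff)
  then show ?thesis
    by (simp only: vertex_coords_def vstack_add matrix_add_rdistrib)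
qed

lemma vertex_coords_scaleR: "vertex_coords E x (c *\<^sub>R Y) = c *\<^sub>R vertex_coords E x Y"
proof -
  have "transpose (c *\<^sub>R vstack Y) = c *\<^sub>R transpose (vstack Y)"
    by (simp add: transpose_def vec_eq_iff)
  then show ?thesis
    by (simp only: vertex_coords_def vstack_scaleR scaleR_matrix_mult)
qed

lemma vertex_coords_right_mult:
  "vertex_coords E x (right_mult Y Q) = transpose Q ** vertex_coords E x Y"
  by (simp add: vertex_coords_def vstack_right_mult matrix_transpose_mul matrix_mul_assoc)

lemma linear_residual: "linear (residual E x)"
proof (rule linearI)
  show "residual E x (X + Y) = residual E x X + residual E x Y" for X Y
    by (simp add: residual_def vec_eq_iff vertex_coords_add matrix_vector_mult_def transpose_def
        sum.distrib distrib_right)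
  show "residual E x (c *\<^sub>R Y) = c *\<^sub>R residual E x Y" for c Y
    by (simp add: residual_def vec_eq_iff vertex_coords_scaleR matrix_vector_mult_def transpose_def
        sum_distrib_left right_diff_distrib mult_ac)
qed

lemma right_mult_nth: "right_mult Y Q $ i = Y $ i ** Q"
  by (simp add: right_mult_def)

lemma residual_right_mult:
  "residual E x (right_mult Y Q) = (\<chi> k i. transpose Q *v (residual E x Y $ k $ i))"
proof -
  have "residual E x (right_mult Y Q) $ k $ i = transpose Q *v (residual E x Y $ k $ i)" for k i
    by (simp add: residual_def vertex_coords_right_mult column_diff_mult right_mult_nth
        matrix_transpose_mul matrix_vector_mult_diff_distrib matrix_vector_mul_assoc
        del: transpose_matrix_vector)
  note eq = this
  show ?thesis
    by (simp only: vec_lambda_eta flip: eq)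
qed

lemma realization_eq_vertex_coords:
  "realization E x Y = point_columns (vertex_coords E x Y) ** centering"
  by (simp only: realization_def vertex_coords_def mult_point_columns)

lemma mult_centering_nth:
  "(p ** centering) $ a $ k = p $ a $ k - (\<Sum>l\<in>UNIV. p $ a $ l) / real CARD('n)"
  for p :: "real^'n^'d"
  by (simp add: centering_def matrix_diff_ldistrib)
    (simp add: matrix_matrix_mult_def outer_def sum_divide_distrib)

lemma realization_centering: "realization E x Y ** centering = realization E x Y"
  by (simp add: vec_eq_iff mult_centering_nth realization_row_sum)

lemma linear_mult_right: "linear (\<lambda>p. p ** M)" for M :: "real^'b^'a"
  by (rule linearI)
    (simp_all add: vec_eq_iff matrix_matrix_mult_def sum.distrib sum_distrib_left algebra_simps)

lemma linear_realization: "linear (realization E x)"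
proof -
  have "linear (\<lambda>Y. point_columns (vertex_coords E x Y))"
    by (rule linearI)
      (simp_all add: vec_eq_iff point_columns_def vertex_coords_add vertex_coords_scaleR)
  from linear_compose[OF this linear_mult_right] show ?thesis
    by (simp add: o_def realization_eq_vertex_coords[abs_def])
qed

text \<open>Differences within one view cancel both the view translation and the shift made by
  \<open>centering\<close>.\<close>

lemma residual_zero_edge:
  assumes "residual E x Y = 0" "(k, i) \<in> E" "(l, i) \<in> E"
  shows "transpose (Y $ i) *v (x k i - x l i) =
    column k (realization E x Y) - column l (realization E x Y)"
proof -
  have "transpose (Y $ i) *v x j i =
     (\<chi> a. vertex_coords E x Y $ a $ Inl j - vertex_coords E x Y $ a $ Inr i)" if "(j, i) \<in> E" for j
  proof -
    have "residual E x Y $ j $ i = 0" using assms(1) by simp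
    then show ?thesis using that by (simp add: residual_def)
  qed
  then show ?thesis
    using assms(2,3)
    by (simp add: matrix_vector_mult_diff_distrib vec_eq_iff column_def realization_eq_vertex_coords
        mult_centering_nth point_columns_def del: transpose_matrix_vector)
qed

text \<open>Points and translations that match every edge exactly solve the normal equations, so the
  vertex coordinates differ from them only by the mean over all vertices. That mean cancels along
  edges and under \<open>centering\<close>.\<close>

lemma residual_zeroI:
  fixes x :: "'n::finite \<Rightarrow> 'm::finite \<Rightarrow> real^'d" and p :: "real^'n^'d"
  assumes "graph_connected E"
    and edge: "\<And>k i. (k, i) \<in> E \<Longrightarrow> transpose (Y $ i) *v x k i = column k p - t i"
  shows "residual E x Y = 0" and "realization E x Y = p ** centering"
proof -
  define w :: "'d \<Rightarrow> real^('n + 'm)"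
    where "w a = (\<chi> v. case v of Inl k \<Rightarrow> p $ a $ k | Inr i \<Rightarrow> t i $ a)" for a
  define c where "c a = (\<Sum>v\<in>UNIV. w a $ v) / real CARD('n + 'm)" for a
  have "(transpose (vstack Y) ** mat_B E x) $ a = mat_L E *v w a" for a
    unfolding vstack_mat_B_row mat_L_mult
    by (rule sum.cong[OF refl])
      (auto simp: edge w_def column_def simp del: transpose_matrix_vector)
  then have "vertex_coords E x Y $ a = (pinv (mat_L E) ** mat_L E) *v w a" for a
    unfolding vertex_coords_def matrix_mult_row[of _ "pinv (mat_L E)"] pinv_mat_L[OF assms(1)]
    by (simp only: matrix_vector_mul_assoc pinv_mat_L[OF assms(1)])
  then have z: "vertex_coords E x Y $ a $ v = w a $ v - c a" for a v
    by (simp add: pinv_mat_L[OF assms(1)] matrix_vector_mult_diff_rdistrib averaging_mult c_def)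
  show "residual E x Y = 0"
    by (simp add: residual_def vec_eq_iff z w_def edge column_def del: transpose_matrix_vector)
  show "realization E x Y = p ** centering"
    by (simp add: realization_eq_vertex_coords vec_eq_iff mult_centering_nth point_columns_def z w_def
        sum_subtractf field_simps)
qed

section \<open>Recovering a stack from its realization\<close>

lemma affinely_nondegenerate_span:
  fixes x :: "'n::finite \<Rightarrow> 'm \<Rightarrow> real^'d"
  assumes "affinely_nondegenerate E x i"
  obtains k0 where "(k0, i) \<in> E" "span ((\<lambda>k. x k i - x k0 i) ` view_points E i) = UNIV"
proof -
  have "view_points E i \<noteq> {}"
    using assms unfolding affinely_nondegenerate_def by (metis card.empty not_one_le_zero add_leE)
  then obtain k0 where k0: "k0 \<in> view_points E i" by blast
  let ?A = "(\<lambda>k. x k i) ` view_points E i"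
  have "aff_dim ?A = int CARD('d)"
    using assms by (simp add: affinely_nondegenerate_def aff_dim_affine_hull)
  moreover have "x k0 i \<in> affine hull ?A"
    using k0 by (intro hull_inc) auto
  ultimately have "dim ((\<lambda>y. y - x k0 i) ` ?A) = DIM(real^'d)"
    by (simp add: aff_dim_eq_dim_subtract)
  then have "span ((\<lambda>y. y - x k0 i) ` ?A) = UNIV"
    by (simp only: dim_eq_full)
  then show thesis
    using that k0 by (simp add: image_image view_points_def)
qed

lemma realization_eq_0_imp_eq_0:
  fixes x :: "'n::finite \<Rightarrow> 'm::finite \<Rightarrow> real^'d"
  assumes nd: "\<And>i. affinely_nondegenerate E x i"
    and Y: "residual E x Y = 0" "realization E x Y = 0"
  shows "Y = 0"
proof -
  have "Y $ i = 0" for i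
  proof -
    obtain k0 where k0: "(k0, i) \<in> E"
      and span: "span ((\<lambda>k. x k i - x k0 i) ` view_points E i) = UNIV"
      using affinely_nondegenerate_span[OF nd] .
    have "transpose (Y $ i) *v (x k i - x k0 i) = 0" if "k \<in> view_points E i" for k
      unfolding residual_zero_edge[OF Y(1) that[unfolded view_points_def mem_Collect_eq] k0]
      by (simp add: Y(2) column_def)
    then have "transpose (Y $ i) *v v = 0" for v
      using linear_eq_0_on_span[of "(*v) (transpose (Y $ i))" "(\<lambda>k. x k i - x k0 i) ` view_points E i" v]
      by (auto simp: span simp del: transpose_matrix_vector)
    then have "transpose (Y $ i) = 0"
      by (simp add: matrix_eq del: transpose_matrix_vector)
    then show ?thesis
      by (simp add: transpose_def vec_eq_iff)
  qed
  then show ?thesis by (simp add: vec_eq_iff)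
qed

text \<open>Linearity of the inverse is the point: it is bounded, so nearby realizations come from
  nearby stacks, and it carries velocities of configurations to velocities of stacks.\<close>

lemma realization_left_inverse:
  fixes x :: "'n::finite \<Rightarrow> 'm::finite \<Rightarrow> real^'d"
  assumes "\<And>i. affinely_nondegenerate E x i"
  obtains g where "linear g" "\<And>Y. residual E x Y = 0 \<Longrightarrow> g (realization E x Y) = Y"
proof -
  let ?K = "{Y. residual E x Y = 0}"
  have "subspace ?K"
    using linear_subspace_kernel[OF linear_residual] .
  moreover have "inj_on (realization E x) ?K"
    using linear_inj_on_iff_eq_0[OF linear_realization \<open>subspace ?K\<close>] realization_eq_0_imp_eq_0 assms
    by blast
  ultimately show thesis
    using linear_exists_left_inverse_on[OF linear_realization] that by blast
qed

lemma perfect_iff_residual: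
  assumes "graph_connected E"
  shows "perfect E x Y \<longleftrightarrow> alignment Y \<and> residual E x Y = 0"
  by (simp add: perfect_def align_error_eq_residual[OF assms])

subsection \<open>Local rigidity and strict minima\<close>

lemma right_mult_right_mult: "right_mult (right_mult Y P) Q = right_mult Y (P ** Q)"
  by (simp add: right_mult_def matrix_mul_assoc)

lemma right_mult_mat_1: "right_mult Y (mat 1) = Y"
  by (simp add: right_mult_def)

lemma alignment_right_mult:
  "alignment Y \<Longrightarrow> orthogonal_matrix Q \<Longrightarrow> alignment (right_mult Y Q)"
  by (simp add: alignment_def right_mult_def orthogonal_matrix_mul)

lemma residual_right_mult_zero: "residual E x Y = 0 \<Longrightarrow> residual E x (right_mult Y Q) = 0"
  by (simp add: residual_right_mult vec_eq_iff[of _ "0 :: real^_^_^_"] vec_eq_iff[of _ "0 :: real^_^_"])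

text \<open>On alignments the value prescribed at block \<open>r\<close> is no exception, since that
  block times its transpose is the identity. The projection thus stays in the orbit of
  \<open>S\<close>, where zero residuals persist.\<close>

lemma quot_proj_eq_right_mult:
  assumes "alignment S"
  shows "quot_proj r S = right_mult S (transpose (S $ r))"
  unfolding quot_proj_def right_mult_def using assms
  by (intro arg_cong[where f = vec_lambda] ext) (auto simp: alignment_def orthogonal_matrix_def)

lemma reduced_alignments_iff: "T \<in> reduced_alignments r \<longleftrightarrow> alignment T \<and> T $ r = mat 1"
  unfolding reduced_alignments_def alignment_def mem_Collect_eq by (metis orthogonal_matrix_id)

lemma quot_proj_reduced:
  assumes "alignment S"
  shows "quot_proj r S \<in> reduced_alignments r"
  unfolding reduced_alignments_iff
  using assms
  by (auto simp: quot_proj_eq_right_mult intro!: alignment_right_mult)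
     (auto simp: alignment_def right_mult_def orthogonal_matrix_def)

lemma with_id_reduced:
  assumes "T $ r = mat 1"
  shows "with_id r T = T"
proof -
  have "(\<lambda>i. if i = r then mat 1 else T $ i) = ($) T" using assms by auto
  then show ?thesis by (simp add: with_id_def)
qed

lemma red_error_eq_residual:
  assumes "graph_connected E"
  shows "red_error E x r T = (norm (residual E x (with_id r T)))\<^sup>2"
  using align_error_eq_residual[OF assms, of x "with_id r T"]
  by (simp add: red_error_def align_error_def)

text \<open>The reduced error is nonnegative, so a zero is a global minimizer at once and strictness
  only says that no other zero is near.\<close>

lemma strict_global_min_iff_isolated:
  assumes "graph_connected E" and T: "T \<in> reduced_alignments r" "residual E x T = 0"
  shows "strict_global_min E x r T \<longleftrightarrow>
    (\<exists>e>0. \<forall>X\<in>reduced_alignments r. dist X T < e \<longrightarrow> residual E x X = 0 \<longrightarrow> X = T)"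
proof -
  have err: "red_error E x r X = (norm (residual E x X))\<^sup>2" if "X \<in> reduced_alignments r" for X
    using that by (simp add: red_error_eq_residual[OF assms(1)] reduced_alignments_iff with_id_reduced)
  have T0: "red_error E x r T = 0" by (simp add: err T)
  show ?thesis
  proof
    assume "strict_global_min E x r T"
    then obtain U where U: "openin (top_of_set (reduced_alignments r)) U" "T \<in> U"
      "\<And>X. X \<in> U - {T} \<Longrightarrow> red_error E x r X > 0"
      unfolding strict_global_min_def T0 by blast
    then obtain e where e: "e > 0" "\<And>X. X \<in> reduced_alignments r \<Longrightarrow> dist X T < e \<Longrightarrow> X \<in> U"
      unfolding openin_euclidean_subtopology_iff by blast
    have "X = T" if X: "X \<in> reduced_alignments r" "dist X T < e" "residual E x X = 0" for X
      using U(3)[of X] e(2)[OF X(1,2)] err[OF X(1)] X(3) by auto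
    then show "\<exists>e>0. \<forall>X\<in>reduced_alignments r. dist X T < e \<longrightarrow> residual E x X = 0 \<longrightarrow> X = T"
      using e(1) by blast
  next
    assume "\<exists>e>0. \<forall>X\<in>reduced_alignments r. dist X T < e \<longrightarrow> residual E x X = 0 \<longrightarrow> X = T"
    then obtain e where e: "e > 0"
      "\<And>X. X \<in> reduced_alignments r \<Longrightarrow> dist X T < e \<Longrightarrow> residual E x X = 0 \<Longrightarrow> X = T"
      by blast
    let ?U = "reduced_alignments r \<inter> ball T e"
    have "openin (top_of_set (reduced_alignments r)) ?U" "T \<in> ?U"
      using e(1) T(1) by auto
    moreover have "red_error E x r X > red_error E x r T" if "X \<in> ?U - {T}" for X
      using e(2)[of X] that err[of X] T0 by (auto simp: dist_commute)
    moreover have "red_error E x r T \<le> red_error E x r X" if "X \<in> reduced_alignments r" for X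
      by (simp add: T0 err that)
    ultimately show "strict_global_min E x r T"
      using T(1) unfolding strict_global_min_def by blast
  qed
qed

lemma linear_small:
  fixes f :: "'a::euclidean_space \<Rightarrow> 'b::real_normed_vector"
  assumes "linear f" "e > 0"
  obtains d where "d > 0" "\<And>x y. norm (x - y) < d \<Longrightarrow> norm (f x - f y) < e"
proof -
  obtain B where B: "B > 0" "\<And>x. norm (f x) \<le> B * norm x"
    using linear_bounded_pos[OF assms(1)] by blast
  have "norm (f x - f y) < e" if "norm (x - y) < e / B" for x y
    using B(2)[of "x - y"] that B(1) by (simp add: linear_diff[OF assms(1)] pos_less_divide_eq mult.commute)
  then show thesis
    using that[of "e / B"] B(1) assms(2) by simp
qed

text \<open>Realization and its left inverse are bounded linear maps, so the radius in the
  definition of rigidity can be moved from configurations to stacks.\<close>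

lemma locally_rigid_iff_right_mult:
  fixes x :: "'n::finite \<Rightarrow> 'm::finite \<Rightarrow> real^'d"
  assumes conn: "graph_connected E" and nd: "\<And>i. affinely_nondegenerate E x i"
    and S: "perfect E x S"
  shows "locally_rigid E x S \<longleftrightarrow>
    (\<exists>e>0. \<forall>O'. perfect E x O' \<and> norm (O' - S) < e \<longrightarrow> (\<exists>Q. orthogonal_matrix Q \<and> O' = right_mult S Q))"
proof -
  obtain g where g: "linear g" "\<And>Y. residual E x Y = 0 \<Longrightarrow> g (realization E x Y) = Y"
    using realization_left_inverse[OF nd] by blast
  have resS: "residual E x S = 0" using S by (simp add: perfect_iff_residual[OF conn])
  have eq: "realization E x O' = realization E x (right_mult S Q) \<longleftrightarrow> O' = right_mult S Q"
    if "perfect E x O'" for O' Q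
    using g(2) residual_right_mult_zero[OF resS] that by (metis perfect_iff_residual[OF conn])
  show ?thesis
  proof
    assume "locally_rigid E x S"
    then obtain e where e: "e > 0" "\<And>O'. perfect E x O' \<Longrightarrow> norm (realization E x O' - realization E x S) < e
      \<Longrightarrow> \<exists>Q. orthogonal_matrix Q \<and> O' = right_mult S Q"
      unfolding locally_rigid_def using eq by metis
    obtain d where "d > 0" "\<And>X Y. norm (X - Y) < d \<Longrightarrow> norm (realization E x X - realization E x Y) < e"
      using linear_small[OF linear_realization e(1)] by metis
    then show "\<exists>e>0. \<forall>O'. perfect E x O' \<and> norm (O' - S) < e \<longrightarrow> (\<exists>Q. orthogonal_matrix Q \<and> O' = right_mult S Q)"
      using e(2) by blast
  next
    assume "\<exists>e>0. \<forall>O'. perfect E x O' \<and> norm (O' - S) < e \<longrightarrow> (\<exists>Q. orthogonal_matrix Q \<and> O' = right_mult S Q)"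
    then obtain e where e: "e > 0" "\<And>O'. perfect E x O' \<Longrightarrow> norm (O' - S) < e
      \<Longrightarrow> \<exists>Q. orthogonal_matrix Q \<and> O' = right_mult S Q"
      by blast
    obtain d where d: "d > 0" "\<And>p q. norm (p - q) < d \<Longrightarrow> norm (g p - g q) < e"
      using linear_small[OF g(1) e(1)] by metis
    have "norm (O' - S) < e" if "perfect E x O'" "norm (realization E x O' - realization E x S) < d" for O'
      using d(2)[OF that(2)] that(1) g(2) resS by (simp add: perfect_iff_residual[OF conn])
    then show "locally_rigid E x S"
      unfolding locally_rigid_def using d(1) e(2) by metis
  qed
qed

lemma locally_rigid_iff_strict_global_min:
  fixes x :: "'n::finite \<Rightarrow> 'm::finite \<Rightarrow> real^'d"
  assumes conn: "graph_connected E" and nd: "\<And>i. affinely_nondegenerate E x i"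
    and S: "perfect E x S"
  shows "locally_rigid E x S \<longleftrightarrow> strict_global_min E x r (quot_proj r S)"
proof -
  have al: "alignment S" and resS: "residual E x S = 0"
    using S by (simp_all add: perfect_iff_residual[OF conn])
  let ?T = "quot_proj r S"
  have T: "?T = right_mult S (transpose (S $ r))"
    by (rule quot_proj_eq_right_mult[OF al])
  have Sr: "orthogonal_matrix (S $ r)" using al by (simp add: alignment_def)
  have TS: "right_mult ?T (S $ r) = S"
    using Sr by (simp add: T right_mult_right_mult orthogonal_matrix_def right_mult_mat_1)
  have Tred: "?T \<in> reduced_alignments r" by (rule quot_proj_reduced[OF al])
  have Tres: "residual E x ?T = 0" by (simp add: T residual_right_mult_zero resS)
  show ?thesis
    unfolding strict_global_min_iff_isolated[OF conn Tred Tres]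
      locally_rigid_iff_right_mult[OF conn nd S]
  proof
    assume "\<exists>e>0. \<forall>O'. perfect E x O' \<and> norm (O' - S) < e \<longrightarrow> (\<exists>Q. orthogonal_matrix Q \<and> O' = right_mult S Q)"
    then obtain e where e: "e > 0" "\<And>O'. perfect E x O' \<Longrightarrow> norm (O' - S) < e
      \<Longrightarrow> \<exists>Q. orthogonal_matrix Q \<and> O' = right_mult S Q"
      by blast
    have lin: "linear (\<lambda>X :: real^'d^'d^'m. right_mult X (S $ r))"
      by (rule linearI)
        (simp_all add: right_mult_def vec_eq_iff matrix_matrix_mult_def sum.distrib sum_distrib_left algebra_simps)
    obtain d where d: "d > 0" "\<And>X Y :: real^'d^'d^'m. norm (X - Y) < d \<Longrightarrow>
        norm (right_mult X (S $ r) - right_mult Y (S $ r)) < e"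
      using linear_small[OF lin e(1)] by metis
    have "X = ?T" if X: "X \<in> reduced_alignments r" "dist X ?T < d" "residual E x X = 0" for X
    proof -
      let ?O = "right_mult X (S $ r)"
      have "perfect E x ?O"
        using X(1,3) Sr by (simp add: perfect_iff_residual[OF conn] reduced_alignments_iff
            alignment_right_mult residual_right_mult_zero)
      moreover have "norm (?O - S) < e"
        using d(2)[of X ?T] X(2) by (simp add: TS dist_norm)
      ultimately obtain Q where Q: "?O = right_mult S Q"
        using e(2) by blast
      \<comment> \<open>Since \<open>X\<close> has the identity in block \<open>r\<close>, that
        block of \<open>?O\<close> is the one of \<open>S\<close>; comparison forces the rotation
        \<open>Q\<close> to be trivial.\<close>
      then have "?O $ r = S $ r ** Q" by (simp add: right_mult_def)
      moreover have "?O $ r = S $ r"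
        using X(1) by (simp add: right_mult_def reduced_alignments_iff)
      ultimately have "transpose (S $ r) ** (S $ r) = (transpose (S $ r) ** S $ r) ** Q"
        by (metis matrix_mul_assoc)
      then have "Q = mat 1"
        using Sr by (simp add: orthogonal_matrix_def)
      then have "right_mult ?O (transpose (S $ r)) = ?T"
        by (simp add: Q right_mult_mat_1 T)
      then show ?thesis
        using Sr by (simp add: right_mult_right_mult orthogonal_matrix_def right_mult_mat_1)
    qed
    then show "\<exists>e>0. \<forall>X\<in>reduced_alignments r. dist X ?T < e \<longrightarrow> residual E x X = 0 \<longrightarrow> X = ?T"
      using d(1) by blast
  next
    assume "\<exists>e>0. \<forall>X\<in>reduced_alignments r. dist X ?T < e \<longrightarrow> residual E x X = 0 \<longrightarrow> X = ?T"
    then obtain e where e: "e > 0"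
      "\<And>X. X \<in> reduced_alignments r \<Longrightarrow> dist X ?T < e \<Longrightarrow> residual E x X = 0 \<Longrightarrow> X = ?T"
      by blast
    \<comment> \<open>On alignments this polynomial map is \<open>quot_proj r\<close>; its
      continuity brings the projections of alignments near \<open>S\<close> close to
      \<open>?T\<close>.\<close>
    have "continuous_on UNIV (\<lambda>Y :: real^'d^'d^'m. right_mult Y (transpose (Y $ r)))"
      unfolding right_mult_def matrix_matrix_mult_def transpose_def
      by (simp, intro continuous_intros)
    then obtain d where d: "d > 0" "\<And>Y. dist Y S < d \<Longrightarrow>
        dist (right_mult Y (transpose (Y $ r))) (right_mult S (transpose (S $ r))) < e"
      using e(1) unfolding continuous_on_iff by (metis UNIV_I)
    have "\<exists>Q. orthogonal_matrix Q \<and> O' = right_mult S Q"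
      if O': "perfect E x O'" "norm (O' - S) < d" for O'
    proof -
      have al': "alignment O'" and res': "residual E x O' = 0"
        using O'(1) by (simp_all add: perfect_iff_residual[OF conn])
      have Or: "orthogonal_matrix (O' $ r)" using al' by (simp add: alignment_def)
      let ?X = "quot_proj r O'"
      have X: "?X = right_mult O' (transpose (O' $ r))"
        by (rule quot_proj_eq_right_mult[OF al'])
      have "?X = ?T"
      proof (rule e(2))
        show "?X \<in> reduced_alignments r" by (rule quot_proj_reduced[OF al'])
        show "dist ?X ?T < e" using d(2)[of O'] O'(2) by (simp add: X T dist_norm)
        show "residual E x ?X = 0" by (simp add: X residual_right_mult_zero res')
      qed
      then have "right_mult (right_mult O' (transpose (O' $ r))) (O' $ r)
          = right_mult (right_mult S (transpose (S $ r))) (O' $ r)"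
        by (simp add: X T)
      then have "O' = right_mult S (transpose (S $ r) ** O' $ r)"
        using Or by (simp add: right_mult_right_mult orthogonal_matrix_def right_mult_mat_1)
      moreover have "orthogonal_matrix (transpose (S $ r) ** O' $ r)"
        using Sr Or by (simp add: orthogonal_matrix_mul orthogonal_matrix_transpose)
      ultimately show ?thesis by blast
    qed
    then show "\<exists>e>0. \<forall>O'. perfect E x O' \<and> norm (O' - S) < e \<longrightarrow> (\<exists>Q. orthogonal_matrix Q \<and> O' = right_mult S Q)"
      using d(1) by blast
  qed
qed

subsection \<open>The Hessian at a perfect alignment\<close>

text \<open>The error is R.R with R affine. Its second derivative along the field is the Gram term
  plus a term with the factor R(T). The latter carries the derivative of the field and vanishes
  because \<open>T\<close> has residual 0.\<close>

lemma hessian_red_error: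
  fixes x :: "'n::finite \<Rightarrow> 'm::finite \<Rightarrow> real^'d"
  assumes conn: "graph_connected E"
    and T: "T \<in> reduced_alignments r" "residual E x T = 0"
    and V: "V \<in> reduced_tangent r T" and W: "W \<in> reduced_tangent r T"
  shows "hessian (red_error E x r) T V W = 2 * (residual E x V \<bullet> residual E x W)"
proof -
  let ?R = "residual E x" and ?F = "red_error E x r" and ?X = "right_inv_field T W"
  \<comment> \<open>Splitting \<open>with_id\<close> into a linear part and a constant exhibits the
    error as the squared norm of an affine function also off the manifold, where the Frechet
    derivatives are taken.\<close>
  define zb where "zb X = (\<chi> i. if i = r then 0 else X $ i)" for X :: "real^'d^'d^'m"
  define I :: "real^'d^'d^'m" where "I = (\<chi> i. if i = r then mat 1 else 0)"
  have w: "with_id r X = zb X + I" for X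
    by (simp add: with_id_def zb_def I_def vec_eq_iff)
  have "linear zb"
    by (rule linearI) (simp_all add: zb_def vec_eq_iff)
  from linear_compose[OF this linear_residual] have Rz: "bounded_linear (\<lambda>X. ?R (zb X))"
    by (simp add: o_def linear_conv_bounded_linear)
  have linX: "linear ?X"
    by (rule linearI)
      (simp_all add: right_inv_field_def vec_eq_iff matrix_matrix_mult_def sum.distrib
        sum_distrib_left algebra_simps)
  have RzX: "bounded_linear (\<lambda>X. ?R (zb (?X X)))"
    using bounded_linear_compose[OF Rz] linX linear_conv_bounded_linear by blast
  have F: "?F X = ?R (zb X + I) \<bullet> ?R (zb X + I)" for X
    by (simp add: red_error_eq_residual[OF conn] w power2_norm_eq_inner)
  have dR: "((\<lambda>X. ?R (zb X + I)) has_derivative (\<lambda>H. ?R (zb H))) (at X)" for X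
    unfolding linear_add[OF linear_residual]
    using has_derivative_add[OF bounded_linear_imp_has_derivative[OF Rz] has_derivative_const] by simp
  have "(?F has_derivative (\<lambda>H. 2 * (?R (zb X + I) \<bullet> ?R (zb H)))) (at X)" for X
    unfolding F[abs_def]
    using has_derivative_inner[OF dR dR] by (simp add: inner_commute)
  then have fF: "frechet_derivative ?F (at X) = (\<lambda>H. 2 * (?R (zb X + I) \<bullet> ?R (zb H)))" for X
    by (metis frechet_derivative_at)
  have TI: "zb T + I = T"
    using T(1) w with_id_reduced by (metis reduced_alignments_iff)
  have zbV: "zb V = V" and zbW: "zb W = W"
    using V W by (auto simp: zb_def reduced_tangent_def vec_eq_iff)
  have "W $ i ** transpose (T $ i) ** T $ i = W $ i" for i
    using T(1) by (simp add: reduced_alignments_iff alignment_def orthogonal_matrix_def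
        flip: matrix_mul_assoc)
  then have XT: "?X T = W"
    by (simp add: right_inv_field_def)
  have "((\<lambda>X. 2 * (?R (zb X + I) \<bullet> ?R (zb (?X X)))) has_derivative
      (\<lambda>H. 2 * (?R (zb T + I) \<bullet> ?R (zb (?X H)) + ?R (zb H) \<bullet> ?R (zb (?X T))))) (at T)"
    by (intro has_derivative_mult_right has_derivative_inner dR
        bounded_linear_imp_has_derivative[OF RzX])
  then have "frechet_derivative (\<lambda>X. 2 * (?R (zb X + I) \<bullet> ?R (zb (?X X)))) (at T) V =
      2 * (?R T \<bullet> ?R (zb (?X V)) + ?R V \<bullet> ?R W)"
    by (metis (no_types, lifting) TI XT zbV zbW frechet_derivative_at)
  then show ?thesis
    by (simp add: hessian_def fF T(2))
qed

text \<open>Choosing \<open>W = V\<close> in the Gram form gives a squared norm, so the degenerate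
  directions are the tangent vectors with zero residual.\<close>

lemma hessian_nonsingular_iff:
  fixes x :: "'n::finite \<Rightarrow> 'm::finite \<Rightarrow> real^'d"
  assumes "graph_connected E" "T \<in> reduced_alignments r" "residual E x T = 0"
  shows "hessian_nonsingular r (red_error E x r) T \<longleftrightarrow>
    (\<forall>V\<in>reduced_tangent r T. residual E x V = 0 \<longrightarrow> V = 0)"
proof -
  have "(\<forall>W\<in>reduced_tangent r T. hessian (red_error E x r) T V W = 0) \<longleftrightarrow> residual E x V = 0"
    if "V \<in> reduced_tangent r T" for V
    using that by (auto simp: hessian_red_error[OF assms])
  then show ?thesis
    unfolding hessian_nonsingular_def by blast
qed

text \<open>The defect \<open>X\<^sub>i\<^sup>T X\<^sub>i - I\<close> is quadratic in \<open>X - T\<close> up to the linear map defining the tangent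
  space, so near \<open>T\<close> it cannot compensate an injective linear map.\<close>

lemma hessian_nonsingular_imp_strict_global_min:
  fixes x :: "'n::finite \<Rightarrow> 'm::finite \<Rightarrow> real^'d"
  assumes conn: "graph_connected E"
    and T: "T \<in> reduced_alignments r" "residual E x T = 0"
    and ns: "hessian_nonsingular r (red_error E x r) T"
  shows "strict_global_min E x r T"
proof -
  let ?R = "residual E x"
  define D where "D V = (\<chi> i. transpose (T $ i) ** V $ i + transpose (V $ i) ** T $ i)"
    for V :: "real^'d^'d^'m"
  \<comment> \<open>The first two components cut out the tangent space and the third the zero
    residual, so nonsingularity of the Hessian is injectivity of \<open>\<Lambda>\<close>.\<close>
  define \<Lambda> where "\<Lambda> V = (V $ r, D V, ?R V)" for V
  have linD: "linear D"
    by (rule linearI)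
      (simp_all add: D_def vec_eq_iff matrix_matrix_mult_def transpose_def sum.distrib
        sum_distrib_left algebra_simps)
  have lin: "linear \<Lambda>"
    by (rule linearI)
      (simp_all add: \<Lambda>_def linear_add[OF linD] linear_scale[OF linD]
        linear_add[OF linear_residual] linear_scale[OF linear_residual])
  have "V = 0" if "\<Lambda> V = 0" for V
  proof -
    have "V \<in> reduced_tangent r T" "?R V = 0"
      using that by (auto simp: \<Lambda>_def D_def reduced_tangent_def vec_eq_iff[of "vec_lambda _"] zero_prod_def)
    then show ?thesis
      using ns unfolding hessian_nonsingular_iff[OF conn T] by blast
  qed
  then have "inj \<Lambda>"
    using linear_injective_0[OF lin] by blast
  then obtain c where c: "c > 0" "\<And>V. c * norm V \<le> norm (\<Lambda> V)"
    using linear_inj_bounded_below_pos[OF lin] by blast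
  define Q where "Q V V' = (\<chi> i. transpose (V $ i) ** V' $ i)" for V V' :: "real^'d^'d^'m"
  have "bilinear Q"
    unfolding bilinear_def
    by (auto intro!: linearI simp: Q_def vec_eq_iff matrix_matrix_mult_def transpose_def sum.distrib
        sum_distrib_left algebra_simps)
  then obtain K where K: "K > 0" "\<And>V V'. norm (Q V V') \<le> K * norm V * norm V'"
    using bilinear_bounded_pos by blast
  \<comment> \<open>For a zero X = T + V the norm of V satisfies c |V| \<le> |Q V V| \<le> K |V|^2,
    so V is zero or |V| \<ge> c / K; hence the radius.\<close>
  have "X = T" if X: "X \<in> reduced_alignments r" "dist X T < c / K" "?R X = 0" for X
  proof (rule ccontr)
    assume "X \<noteq> T"
    define V where "V = X - T"
    have V0: "norm V > 0" using \<open>X \<noteq> T\<close> by (simp add: V_def)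
    have XV: "X = T + V" by (simp add: V_def)
    have "D V = - Q V V"
    proof -
      have "transpose (X $ i) ** X $ i = transpose (T $ i) ** T $ i +
          (transpose (T $ i) ** V $ i + transpose (V $ i) ** T $ i) + transpose (V $ i) ** V $ i" for i
        unfolding XV
        by (simp add: vec_eq_iff matrix_matrix_mult_def transpose_def sum.distrib algebra_simps)
      moreover have "transpose (X $ i) ** X $ i = mat 1" "transpose (T $ i) ** T $ i = mat 1" for i
        using X(1) T(1) by (simp_all add: reduced_alignments_iff alignment_def orthogonal_matrix_def)
      ultimately have e: "mat 1 = mat 1 +
          (transpose (T $ i) ** V $ i + transpose (V $ i) ** T $ i) + transpose (V $ i) ** V $ i" for i
        by metis
      have "b = - c" if "m = m + b + c" for m b c :: "real^'d^'d"
        using that by (simp add: add.assoc eq_neg_iff_add_eq_0)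
      from this[OF e] show ?thesis
        unfolding D_def Q_def by (simp add: vec_eq_iff[of "vec_lambda _" "- _"])
    qed
    moreover have "V $ r = 0" "?R V = 0"
      using X(1,3) T by (simp_all add: V_def reduced_alignments_iff linear_diff[OF linear_residual])
    ultimately have "norm (\<Lambda> V) = norm (Q V V)"
      by (simp add: \<Lambda>_def norm_Pair)
    then have "c * norm V \<le> K * norm V * norm V"
      using c(2)[of V] K(2)[of V V] by simp
    then have "c \<le> K * norm V"
      using V0 by simp
    then show False
      using X(2) K(1) by (simp add: V_def dist_norm pos_less_divide_eq mult.commute)
  qed
  then show ?thesis
    unfolding strict_global_min_iff_isolated[OF conn T]
    using c(1) K(1) by (intro exI[of _ "c / K"]) auto
qed

subsection \<open>Congruent views\<close>

text \<open>Polarization turns equal distances into equal inner products relative to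
  \<open>k0\<close>. A linear map fixed on a basis chosen among the differences then preserves inner
  products, and its error at any other point is orthogonal to its whole range, which is the full
  space.\<close>

lemma congruent_points_orthogonal:
  fixes a b :: "'k \<Rightarrow> real^'d"
  assumes k0: "k0 \<in> A" and span: "span ((\<lambda>k. a k - a k0) ` A) = UNIV"
    and dist: "\<And>k l. k \<in> A \<Longrightarrow> l \<in> A \<Longrightarrow> dist (b k) (b l) = dist (a k) (a l)"
  obtains Q where "orthogonal_matrix Q" "\<And>k. k \<in> A \<Longrightarrow> b k - b k0 = Q *v (a k - a k0)"
proof -
  define a' where "a' k = a k - a k0" for k
  define b' where "b' k = b k - b k0" for k
  have ip: "b' k \<bullet> b' l = a' k \<bullet> a' l" if "k \<in> A" "l \<in> A" for k l
  proof -
    have "norm (b' k) = norm (a' k)" "norm (b' l) = norm (a' l)"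
      using dist k0 that by (simp_all add: a'_def b'_def dist_norm)
    moreover have "norm (b' k - b' l) = norm (a' k - a' l)"
      using dist that by (simp add: a'_def b'_def dist_norm)
    ultimately show ?thesis
      by (simp add: dot_norm_neg)
  qed
  obtain B where B: "B \<subseteq> a' ` A" "independent B" "a' ` A \<subseteq> span B"
    using maximal_independent_subset by blast
  have spB: "span B = UNIV"
    using span span_mono[OF B(3)] by (auto simp: a'_def[abs_def] span_span)
  have "\<exists>s. \<forall>v\<in>B. s v \<in> A \<and> a' (s v) = v"
    using B(1) by (intro bchoice ballI) blast
  then obtain s where s: "\<And>v. v \<in> B \<Longrightarrow> s v \<in> A" "\<And>v. v \<in> B \<Longrightarrow> a' (s v) = v"
    by blast
  obtain g where g: "linear g" "\<And>v. v \<in> B \<Longrightarrow> g v = b' (s v)"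
    using linear_independent_extend[OF B(2), of "\<lambda>v. b' (s v)"] by blast
  have inner_g: "g v \<bullet> g w = v \<bullet> w" for v w
  proof (rule bilinear_eq[of "\<lambda>v w. g v \<bullet> g w" "\<lambda>v w. v \<bullet> w" UNIV B UNIV B])
    show "bilinear (\<lambda>v w. g v \<bullet> g w)"
      unfolding bilinear_def using g(1)
      by (auto intro!: linearI simp: linear_add linear_scale inner_add_left inner_add_right)
    show "bilinear (\<lambda>v w :: real^'d. v \<bullet> w)"
      unfolding bilinear_def by (auto intro!: linearI simp: inner_add_left inner_add_right)
    show "g v \<bullet> g w = v \<bullet> w" if "v \<in> B" "w \<in> B" for v w
      using ip[OF s(1)[OF that(1)] s(1)[OF that(2)]] that by (simp add: g(2) s(2))
  qed (auto simp: spB)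
  have ot: "orthogonal_transformation g"
    using g(1) inner_g by (simp add: orthogonal_transformation_def)
  have gb: "g (a' k) = b' k" if "k \<in> A" for k
  proof -
    define e where "e = g (a' k) - b' k"
    have "g v \<bullet> e = 0" if "v \<in> B" for v
      using ip[OF s(1)[OF that] \<open>k \<in> A\<close>] that inner_g[of v "a' k"]
      by (simp add: e_def inner_diff_right g(2) s(2))
    moreover have "linear (\<lambda>v. g v \<bullet> e)"
      using g(1) by (auto intro!: linearI simp: linear_add linear_scale inner_add_left)
    ultimately have "g v \<bullet> e = 0" for v
      using linear_eq_0_on_span[of "\<lambda>v. g v \<bullet> e" B v] spB by auto
    moreover obtain v where "g v = e"
      using orthogonal_transformation_surj[OF ot] by (metis surjD)
    ultimately have "e = 0" by (metis inner_eq_zero_iff)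
    then show ?thesis by (simp add: e_def)
  qed
  show thesis
  proof (rule that)
    show "orthogonal_matrix (matrix g)"
      using ot orthogonal_transformation_matrix by blast
    show "b k - b k0 = matrix g *v (a k - a k0)" if "k \<in> A" for k
      using gb[OF that] by (simp add: matrix_works g(1) a'_def b'_def)
  qed
qed

lemma orthogonal_matrix_norm:
  fixes Q :: "real^'d^'d"
  assumes "orthogonal_matrix Q"
  shows "norm (Q *v v) = norm v"
proof -
  have "orthogonal_transformation ((*v) Q)"
    using assms by (simp add: orthogonal_transformation_matrix)
  then show ?thesis
    by (rule orthogonal_transformation_norm)
qed

text \<open>Each view is congruent to its part of the realization of \<open>S\<close>, hence to its
  part of \<open>p\<close>; the transpose of the orthogonal matrix obtained is the new block. This
  lifts configurations with the same in-view distances to perfect alignments.\<close>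

lemma perfect_of_congruent_views:
  fixes x :: "'n::finite \<Rightarrow> 'm::finite \<Rightarrow> real^'d" and p :: "real^'n^'d"
  assumes conn: "graph_connected E" and nd: "\<And>i. affinely_nondegenerate E x i"
    and S: "perfect E x S"
    and dist: "\<And>k l i. (k, i) \<in> E \<Longrightarrow> (l, i) \<in> E \<Longrightarrow>
      dist (column k p) (column l p) = dist (column k (realization E x S)) (column l (realization E x S))"
  obtains Y where "perfect E x Y" "realization E x Y = p ** centering"
proof -
  have al: "alignment S" and resS: "residual E x S = 0"
    using S by (simp_all add: perfect_iff_residual[OF conn])
  have "\<exists>Q t. orthogonal_matrix Q \<and> (\<forall>k. (k, i) \<in> E \<longrightarrow> Q *v x k i = column k p - t)" for i
  proof -
    obtain k0 where k0: "(k0, i) \<in> E"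
      and span: "span ((\<lambda>k. x k i - x k0 i) ` view_points E i) = UNIV"
      using affinely_nondegenerate_span[OF nd] .
    have "dist (column k p) (column l p) = dist (x k i) (x l i)"
      if "k \<in> view_points E i" "l \<in> view_points E i" for k l
    proof -
      have e: "(k, i) \<in> E" "(l, i) \<in> E" using that by (simp_all add: view_points_def)
      have "orthogonal_matrix (transpose (S $ i))"
        using al by (simp add: alignment_def orthogonal_matrix_transpose)
      then show ?thesis
        using dist[OF e] residual_zero_edge[OF resS e] orthogonal_matrix_norm
        by (metis dist_norm)
    qed
    then obtain Q where Q: "orthogonal_matrix Q"
      "\<And>k. k \<in> view_points E i \<Longrightarrow> column k p - column k0 p = Q *v (x k i - x k0 i)"
      using congruent_points_orthogonal[of k0 "view_points E i" "\<lambda>k. x k i" "\<lambda>k. column k p"]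
        k0 span by (auto simp: view_points_def)
    have "Q *v x k i = column k p - (column k0 p - Q *v x k0 i)" if "(k, i) \<in> E" for k
      using Q(2)[of k] that by (simp add: view_points_def matrix_vector_mult_diff_distrib algebra_simps)
    then show ?thesis using Q(1) by blast
  qed
  then obtain Q t where Q: "\<And>i. orthogonal_matrix (Q i)"
    "\<And>k i. (k, i) \<in> E \<Longrightarrow> Q i *v x k i = column k p - t i"
    by metis
  define Y where "Y = (\<chi> i. transpose (Q i))"
  have "transpose (Y $ i) *v x k i = column k p - t i" if "(k, i) \<in> E" for k i
    by (simp add: Y_def Q(2)[OF that] del: transpose_matrix_vector)
  note R = residual_zeroI[OF conn this]
  have "alignment Y"
    using Q(1) by (simp add: alignment_def Y_def orthogonal_matrix_transpose)
  then show thesis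
    using that R by (simp add: perfect_iff_residual[OF conn])
qed

subsection \<open>Flexes at generic realizations\<close>

definition same_view :: "('n \<times> 'm) set \<Rightarrow> 'n \<Rightarrow> 'n \<Rightarrow> bool" where
  "same_view E k l \<longleftrightarrow> (\<exists>i. (k, i) \<in> E \<and> (l, i) \<in> E)"

text \<open>Squared lengths of the bar framework in which the points of each view form a complete
  graph. Squares make the map polynomial; pairs without a common view are padded by 0, which adds
  only zero rows to the Jacobian.\<close>

definition rigidity_map :: "('n::finite \<times> 'm::finite) set \<Rightarrow> real^('d::finite \<times> 'n::finite) \<Rightarrow> real^('n \<times> 'n)" where
  "rigidity_map E y = (\<chi> e. if same_view E (fst e) (snd e)
     then \<Sum>a\<in>UNIV. (y $ (a, fst e) - y $ (a, snd e))\<^sup>2 else 0)"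

definition rigidity_matrix ::
  "('n::finite \<times> 'm::finite) set \<Rightarrow> real^('d::finite \<times> 'n::finite) \<Rightarrow> real^('d \<times> 'n)^('n \<times> 'n)" where
  "rigidity_matrix E y = (\<chi> e v. if same_view E (fst e) (snd e)
     then 2 * (y $ (fst v, fst e) - y $ (fst v, snd e)) *
       ((if snd v = fst e then 1 else 0) - (if snd v = snd e then 1 else 0)) else 0)"

lemma rigidity_matrix_mult:
  fixes y :: "real^('d::finite \<times> 'n::finite)"
  shows "(rigidity_matrix E y *v h) $ e = (if same_view E (fst e) (snd e)
     then \<Sum>a\<in>UNIV. 2 * (y $ (a, fst e) - y $ (a, snd e)) * (h $ (a, fst e) - h $ (a, snd e)) else 0)"
proof (cases "same_view E (fst e) (snd e)")
  case True
  let ?d = "\<lambda>j. (if j = fst e then 1 else 0) - (if j = snd e then 1 else 0) :: real"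
  have "(rigidity_matrix E y *v h) $ e =
      (\<Sum>v\<in>UNIV. 2 * (y $ (fst v, fst e) - y $ (fst v, snd e)) * ?d (snd v) * h $ v)"
    using True by (simp add: rigidity_matrix_def matrix_vector_mult_def)
  also have "\<dots> = (\<Sum>a\<in>UNIV. \<Sum>j\<in>UNIV. 2 * (y $ (a, fst e) - y $ (a, snd e)) * ?d j * h $ (a, j))"
    unfolding sum.cartesian_product UNIV_Times_UNIV by (rule sum.cong) auto
  also have "\<dots> = (\<Sum>a\<in>UNIV. 2 * (y $ (a, fst e) - y $ (a, snd e)) * (h $ (a, fst e) - h $ (a, snd e)))"
  proof (rule sum.cong[OF refl])
    fix a
    have "(\<Sum>j\<in>UNIV. ?d j * h $ (a, j)) =
      (\<Sum>j\<in>UNIV. (if j = fst e then h $ (a, j) else 0) - (if j = snd e then h $ (a, j) else 0))"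
      by (rule sum.cong) auto
    also have "\<dots> = h $ (a, fst e) - h $ (a, snd e)"
      by (simp add: sum_subtractf)
    finally show "(\<Sum>j\<in>UNIV. 2 * (y $ (a, fst e) - y $ (a, snd e)) * ?d j * h $ (a, j)) =
        2 * (y $ (a, fst e) - y $ (a, snd e)) * (h $ (a, fst e) - h $ (a, snd e))"
      by (metis (no_types, lifting) mult.assoc sum.cong sum_distrib_left)
  qed
  finally show ?thesis using True by simp
next
  case False
  then show ?thesis by (simp add: rigidity_matrix_def matrix_vector_mult_def)
qed

lemma has_derivative_rigidity_map:
  fixes y :: "real^('d::finite \<times> 'n::finite)"
  shows "(rigidity_map E has_derivative (\<lambda>h. rigidity_matrix E y *v h)) (at y)"
proof (subst has_derivative_componentwise_within, intro ballI)
  fix b :: "real^('n \<times> 'n)"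
  assume "b \<in> Basis"
  then obtain e where b: "b = axis e 1" by (auto simp: Basis_vec_def)
  have nth: "((\<lambda>y :: real^('d::finite \<times> 'n::finite). y $ v) has_derivative (\<lambda>h. h $ v)) (at y)" for v
    by (rule bounded_linear_imp_has_derivative[OF bounded_linear_vec_nth])
  have "((\<lambda>y :: real^('d::finite \<times> 'n::finite). \<Sum>a\<in>UNIV. (y $ (a, fst e) - y $ (a, snd e))\<^sup>2) has_derivative
      (\<lambda>h. \<Sum>a\<in>UNIV. 2 * (y $ (a, fst e) - y $ (a, snd e)) * (h $ (a, fst e) - h $ (a, snd e)))) (at y)"
    by (auto intro!: derivative_eq_intros nth sum.cong simp: fun_eq_iff algebra_simps)
  then have "((\<lambda>y. rigidity_map E y $ e) has_derivative (\<lambda>h. (rigidity_matrix E y *v h) $ e)) (at y)"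
    unfolding rigidity_matrix_mult rigidity_map_def vec_lambda_beta
    by (cases "same_view E (fst e) (snd e)") (simp_all only: if_True if_False has_derivative_const)
  then show "((\<lambda>y. rigidity_map E y \<bullet> b) has_derivative (\<lambda>h. (rigidity_matrix E y *v h) \<bullet> b)) (at y)"
    by (simp add: b inner_axis)
qed

lemma continuous_on_rigidity_matrix: "continuous_on UNIV (rigidity_matrix E)"
proof -
  have "linear (rigidity_matrix E)"
    by (rule linearI) (simp_all add: rigidity_matrix_def vec_eq_iff algebra_simps)
  then show ?thesis
    using linear_continuous_on linear_conv_bounded_linear by blast
qed

lemma rat_polynomial_rigidity_matrix: "rat_polynomial (\<lambda>y. rigidity_matrix E (\<chi> v. y v) $ e $ v)"
proof -
  have two: "rat_polynomial (\<lambda>y. 2)"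
    using rat_polynomial_of_rat[of 2] by simp
  have ind: "rat_polynomial (\<lambda>y. if c then 1 else 0)" for c
    by (cases c) (simp_all add: rat_polynomial_0 rat_polynomial_1)
  have "(\<lambda>y. rigidity_matrix E (\<chi> v. y v) $ e $ v) =
      (\<lambda>y. (if same_view E (fst e) (snd e) then 1 else 0) *
        (2 * (y (fst v, fst e) - y (fst v, snd e)) *
          ((if snd v = fst e then 1 else 0) - (if snd v = snd e then 1 else 0))))"
    by (rule ext) (simp add: rigidity_matrix_def)
  then show ?thesis
    by (simp only:)
      (intro rat_polynomial_mult rat_polynomial_diff rat_polynomial_var ind two)
qed

text \<open>Conjugated by \<open>S\<close>, the tangency condition says that
  \<open>S ** transpose V\<close> is skew, and the quadratic form of a skew matrix is zero.\<close>

lemma inner_skew: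
  fixes S V :: "real^'d^'d"
  assumes S: "orthogonal_matrix S" and V: "transpose S ** V + transpose V ** S = 0"
  shows "(transpose S *v w) \<bullet> (transpose V *v w) = 0"
proof -
  have SS: "S ** transpose S = mat 1" using S by (simp add: orthogonal_matrix_def)
  have "S ** (transpose S ** V + transpose V ** S) ** transpose S = 0"
    by (simp add: V)
  then have sk: "V ** transpose S + S ** transpose V = 0"
    by (simp add: matrix_add_ldistrib matrix_add_rdistrib matrix_mul_assoc SS)
      (simp add: SS flip: matrix_mul_assoc)
  have "(transpose S *v w) \<bullet> (transpose V *v w) = w \<bullet> ((S ** transpose V) *v w)"
    by (simp only: inner_transpose_mult matrix_vector_mul_assoc)
  moreover have "(transpose V *v w) \<bullet> (transpose S *v w) = w \<bullet> ((V ** transpose S) *v w)"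
    by (simp only: inner_transpose_mult matrix_vector_mul_assoc)
  moreover have "w \<bullet> ((V ** transpose S) *v w) + w \<bullet> ((S ** transpose V) *v w) = 0"
    by (simp add: sk flip: inner_add_right matrix_vector_mult_add_rdistrib)
  ultimately show ?thesis by (simp add: inner_commute)
qed

text \<open>An infinitesimal flex of a generic realization is the velocity of an actual motion that
  preserves all distances within the views.  Local rigidity makes this motion a rotation of \<open>S\<close>,
  so the velocity vanishes once the reference view is pinned.\<close>

lemma generic_locally_rigid_imp_no_flex:
  fixes x :: "'n::finite \<Rightarrow> 'm::finite \<Rightarrow> real^'d"
  assumes conn: "graph_connected E" and nd: "\<And>i. affinely_nondegenerate E x i"
    and S: "perfect E x S" and gen: "generic_up_to_translation (realization E x S)"
    and rigid: "locally_rigid E x S"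
    and V: "residual E x V = 0" "V $ r = 0"
      "\<And>i. transpose (S $ i) ** V $ i + transpose (V $ i) ** S $ i = 0"
  shows "V = 0"
proof -
  let ?\<Theta> = "realization E x"
  have al: "alignment S" and resS: "residual E x S = 0"
    using S by (simp_all add: perfect_iff_residual[OF conn])
  obtain g where g: "linear g" "\<And>Y. residual E x Y = 0 \<Longrightarrow> g (?\<Theta> Y) = Y"
    using realization_left_inverse[OF nd] by blast
  obtain t where t: "generic (translate t (?\<Theta> S))"
    using gen unfolding generic_up_to_translation_def by blast
  define vec :: "real^'n^'d \<Rightarrow> real^('d::finite \<times> 'n::finite)" where "vec P = (\<chi> v. P $ fst v $ snd v)" for P
  define mtx :: "real^('d::finite \<times> 'n::finite) \<Rightarrow> real^'n^'d" where "mtx y = (\<chi> a k. y $ (a, k))" for y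
  have mv: "mtx (vec P) = P" for P by (simp add: mtx_def vec_def vec_eq_iff)
  define p where "p = vec (translate t (?\<Theta> S))"
  define q where "q = vec (?\<Theta> V)"
  have gp: "generic_point p"
    using generic_imp_generic_point[OF t] by (simp add: p_def vec_def)
  have rank: "rank (rigidity_matrix E y) \<le> rank (rigidity_matrix E p)" for y :: "real^('d \<times> 'n)"
    by (rule rank_le_rank_generic_point[OF gp rat_polynomial_rigidity_matrix])
  have ker: "rigidity_matrix E p *v q = 0"
  proof -
    have "(rigidity_matrix E p *v q) $ (k, l) = 0" for k l
    proof (cases "same_view E k l")
      case True
      then obtain i where e: "(k, i) \<in> E" "(l, i) \<in> E"
        unfolding same_view_def by blast
      have "(\<Sum>a\<in>UNIV. (p $ (a, k) - p $ (a, l)) * (q $ (a, k) - q $ (a, l))) =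
          (column k (?\<Theta> S) - column l (?\<Theta> S)) \<bullet> (column k (?\<Theta> V) - column l (?\<Theta> V))"
        by (simp add: p_def q_def vec_def translate_def column_def inner_vec_def)
      also have "\<dots> = 0"
        using inner_skew[OF _ V(3)] al
        unfolding residual_zero_edge[OF resS e, symmetric] residual_zero_edge[OF V(1) e, symmetric]
        by (simp add: alignment_def del: transpose_matrix_vector)
      finally have "(\<Sum>a\<in>UNIV. 2 * (p $ (a, k) - p $ (a, l)) * (q $ (a, k) - q $ (a, l))) = 0"
        by (simp only: mult.assoc mult_zero_right flip: sum_distrib_left)
      then show ?thesis
        by (simp only: rigidity_matrix_mult fst_conv snd_conv if_cancel)
    next
      case False
      then show ?thesis by (simp add: rigidity_matrix_mult)
    qed
    then show ?thesis by (simp add: vec_eq_iff)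
  qed
  obtain c \<delta> where \<delta>: "\<delta> > 0" and c: "c 0 = p" "(c has_vector_derivative q) (at 0)"
    "\<And>s. \<bar>s\<bar> < \<delta> \<Longrightarrow> rigidity_map E (c s) = rigidity_map E p"
    using maximal_rank_fibre_curve[OF has_derivative_rigidity_map continuous_on_rigidity_matrix rank ker]
    by metis
  have dist_mtx: "(dist (column k (mtx y)) (column l (mtx y)))\<^sup>2 = (\<Sum>a\<in>UNIV. (y $ (a, k) - y $ (a, l))\<^sup>2)"
    for k l y
    unfolding dist_norm power2_norm_eq_inner
    by (simp add: inner_vec_def column_def mtx_def power2_eq_square)
  have mtxp: "mtx p = translate t (?\<Theta> S)"
    by (simp add: p_def mv)
  \<comment> \<open>\<open>\<Phi>\<close> recovers a stack of zero residual from its flattened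
    configuration, up to translation. Being linear, it turns the curve of configurations into a
    curve of stacks whose velocity at 0 is \<open>\<Phi> q\<close>, which is
    \<open>V\<close>.\<close>
  define \<Phi> where "\<Phi> y = g (mtx y ** centering)" for y
  have perf: "perfect E x (\<Phi> (c s)) \<and> ?\<Theta> (\<Phi> (c s)) = mtx (c s) ** centering" if "\<bar>s\<bar> < \<delta>" for s
  proof -
    have "dist (column k (mtx (c s))) (column l (mtx (c s))) = dist (column k (?\<Theta> S)) (column l (?\<Theta> S))"
      if e: "(k, i) \<in> E" "(l, i) \<in> E" for k l i
    proof -
      have "rigidity_map E (c s) $ (k, l) = rigidity_map E p $ (k, l)"
        using c(3)[OF \<open>\<bar>s\<bar> < \<delta>\<close>] by simp
      moreover have "same_view E k l" using e unfolding same_view_def by blast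
      ultimately have "(dist (column k (mtx (c s))) (column l (mtx (c s))))\<^sup>2 =
          (dist (column k (mtx p)) (column l (mtx p)))\<^sup>2"
        unfolding dist_mtx by (simp add: rigidity_map_def)
      then have "dist (column k (mtx (c s))) (column l (mtx (c s))) = dist (column k (mtx p)) (column l (mtx p))"
        by simp
      also have "\<dots> = dist (column k (?\<Theta> S)) (column l (?\<Theta> S))"
      proof -
        have "column j (mtx p) = column j (?\<Theta> S) + t" for j
          by (simp add: mtxp translate_def column_def vec_eq_iff)
        then show ?thesis by simp
      qed
      finally show ?thesis .
    qed
    then obtain Y where Y: "perfect E x Y" "?\<Theta> Y = mtx (c s) ** centering"
      using perfect_of_congruent_views[OF conn nd S] by metis
    then have "\<Phi> (c s) = Y"
      using g(2)[of Y] by (simp add: \<Phi>_def perfect_iff_residual[OF conn])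
    then show ?thesis using Y by simp
  qed
  have linm: "linear mtx"
    by (rule linearI) (simp_all add: mtx_def vec_eq_iff)
  have "linear (\<lambda>y. mtx y ** centering)"
    using linear_compose[OF linm linear_mult_right] by (simp add: o_def)
  from linear_compose[OF this g(1)] have lin\<Phi>: "linear \<Phi>"
    by (simp add: o_def \<Phi>_def[abs_def])
  have "mtx p ** centering = ?\<Theta> S ** centering"
    by (simp add: vec_eq_iff mult_centering_nth mtxp translate_def sum.distrib add_divide_distrib)
  then have \<Phi>p: "\<Phi> p = S"
    by (simp add: \<Phi>_def realization_centering g(2) resS)
  have \<Phi>q: "\<Phi> q = V"
    by (simp add: \<Phi>_def q_def mv realization_centering g(2) V(1))
  obtain e where e: "e > 0" "\<And>Y. perfect E x Y \<Longrightarrow> norm (Y - S) < e \<Longrightarrow>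
      \<exists>Q. orthogonal_matrix Q \<and> Y = right_mult S Q"
    using rigid unfolding locally_rigid_iff_right_mult[OF conn nd S] by blast
  have d\<Phi>: "((\<lambda>s. \<Phi> (c s)) has_vector_derivative V) (at 0)"
    using bounded_linear.has_vector_derivative[OF _ c(2)] lin\<Phi> \<Phi>q
    by (metis linear_conv_bounded_linear)
  then have "isCont (\<lambda>s. \<Phi> (c s)) 0"
    by (rule has_vector_derivative_continuous)
  then obtain d where d: "d > 0" "\<And>s. \<bar>s\<bar> < d \<Longrightarrow> norm (\<Phi> (c s) - S) < e"
    using e(1) unfolding continuous_at_eps_delta by (auto simp: dist_norm c(1) \<Phi>p)
  define \<eta> where "\<eta> = min d \<delta>"
  have \<eta>: "\<eta> > 0" using d(1) \<delta> by (simp add: \<eta>_def)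
  \<comment> \<open>If a stack is \<open>right_mult S Q\<close>, its block \<open>r\<close> yields
    \<open>Q\<close> as the transpose of \<open>S $ r\<close> times that block. Eliminating
    \<open>Q\<close> leaves a linear relation in the stack, which survives differentiation and gives
    \<open>V $ i = 0\<close> from \<open>V $ r = 0\<close>.\<close>
  have rot: "\<Phi> (c s) $ i - S $ i ** transpose (S $ r) ** \<Phi> (c s) $ r = 0" if "\<bar>s\<bar> < \<eta>" for s i
  proof -
    have "\<bar>s\<bar> < d" "\<bar>s\<bar> < \<delta>" using that by (auto simp: \<eta>_def)
    then obtain Q where Q: "\<Phi> (c s) = right_mult S Q"
      using e(2) perf d(2) by blast
    have "transpose (S $ r) ** S $ r = mat 1"
      using al by (simp add: alignment_def orthogonal_matrix_def)
    then show ?thesis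
      by (simp add: Q right_mult_nth) (simp flip: matrix_mul_assoc, simp add: matrix_mul_assoc)
  qed
  have "V $ i = 0" for i
  proof -
    define \<Lambda> where "\<Lambda> Y = Y $ i - S $ i ** transpose (S $ r) ** Y $ r" for Y :: "real^'d^'d^'m"
    have "linear \<Lambda>"
      by (rule linearI) (simp_all add: \<Lambda>_def vec_eq_iff matrix_matrix_mult_def sum.distrib
        sum_distrib_left algebra_simps)
    then have "((\<lambda>s. \<Lambda> (\<Phi> (c s))) has_vector_derivative \<Lambda> V) (at 0)"
      using bounded_linear.has_vector_derivative[OF _ d\<Phi>] by (metis linear_conv_bounded_linear)
    moreover have "\<Lambda> (\<Phi> (c s)) = 0" if "s \<in> {- \<eta><..<\<eta>}" for s
      unfolding \<Lambda>_def by (rule rot) (use that in auto)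
    ultimately have "((\<lambda>s. 0) has_vector_derivative \<Lambda> V) (at 0)"
      using has_vector_derivative_transform_within_open[of "\<lambda>s. \<Lambda> (\<Phi> (c s))" "\<Lambda> V" 0
          "{- \<eta><..<\<eta>}" "\<lambda>s. 0"] \<eta> by simp
    then have "\<Lambda> V = 0"
      using vector_derivative_unique_at has_vector_derivative_const by blast
    then show ?thesis by (simp add: \<Lambda>_def V(2))
  qed
  then show ?thesis by (simp add: vec_eq_iff)
qed

theorem theorem4p2:
  fixes E :: "('n::finite \<times> 'm::finite) set"
    and x :: "'n \<Rightarrow> 'm \<Rightarrow> real^'d"
    and r :: 'm
    and S :: "real^'d^'d^'m"
  assumes "graph_connected E"
    and "\<And>i. affinely_nondegenerate E x i"
    and "perfect E x S"
  shows "(locally_rigid E x S \<longleftrightarrow> strict_global_min E x r (quot_proj r S)) \<and>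
    (nondegenerate E x r S \<longrightarrow> locally_rigid E x S) \<and>
    (generic_up_to_translation (realization E x S) \<longrightarrow>
       locally_rigid E x S \<longrightarrow> nondegenerate E x r S)"
proof -
  let ?T = "quot_proj r S"
  have al: "alignment S" and resS: "residual E x S = 0"
    using assms(3) by (simp_all add: perfect_iff_residual[OF assms(1)])
  have T: "?T = right_mult S (transpose (S $ r))"
    by (rule quot_proj_eq_right_mult[OF al])
  have Sr: "transpose (S $ r) ** S $ r = mat 1"
    using al by (simp add: alignment_def orthogonal_matrix_def)
  have Tred: "?T \<in> reduced_alignments r" by (rule quot_proj_reduced[OF al])
  have Tres: "residual E x ?T = 0" by (simp add: T residual_right_mult_zero resS)
  note iff = locally_rigid_iff_strict_global_min[OF assms, of r]
  have "strict_global_min E x r ?T" if "nondegenerate E x r S"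
    using that hessian_nonsingular_imp_strict_global_min[OF assms(1) Tred Tres]
    by (simp add: nondegenerate_def)
  moreover have "nondegenerate E x r S"
    if gen: "generic_up_to_translation (realization E x S)" and rigid: "locally_rigid E x S"
  proof -
    have "strict_global_min E x r ?T" using rigid iff by blast
    then have "local_min E x r ?T"
      unfolding strict_global_min_def local_min_def
      by (intro conjI exI[of _ "reduced_alignments r"]) auto
    moreover have "V = 0" if V: "V \<in> reduced_tangent r ?T" "residual E x V = 0" for V
    proof -
      \<comment> \<open>The tangent vector is based at \<open>?T\<close>, whereas flexes are ruled
        out at \<open>S\<close>; rotation by \<open>S $ r\<close> moves it there and keeps block
        \<open>r\<close> zero.\<close>
      let ?V = "right_mult V (S $ r)"
      have TS: "?T $ i ** S $ r = S $ i" for i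
        by (simp add: T right_mult_nth Sr flip: matrix_mul_assoc)
      have "?V = 0"
      proof (rule generic_locally_rigid_imp_no_flex[OF assms gen rigid])
        show "residual E x ?V = 0" by (rule residual_right_mult_zero[OF V(2)])
        show "?V $ r = 0" using V(1) by (simp add: right_mult_nth reduced_tangent_def)
        show "transpose (S $ i) ** ?V $ i + transpose (?V $ i) ** S $ i = 0" for i
        proof -
          have "transpose (?T $ i) ** V $ i + transpose (V $ i) ** ?T $ i = 0"
            using V(1) by (simp add: reduced_tangent_def)
          then have "transpose (S $ r) ** (transpose (?T $ i) ** V $ i + transpose (V $ i) ** ?T $ i) ** S $ r = 0"
            by simp
          then show ?thesis
            unfolding TS[of i, symmetric] right_mult_nth
            by (simp add: matrix_transpose_mul matrix_add_ldistrib matrix_add_rdistrib matrix_mul_assoc)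
        qed
      qed
      then have "right_mult ?V (transpose (S $ r)) = 0"
        by (simp add: right_mult_def vec_eq_iff matrix_matrix_mult_def)
      then show ?thesis
        using al by (simp add: right_mult_right_mult alignment_def orthogonal_matrix_def right_mult_mat_1)
    qed
    ultimately show ?thesis
      using al hessian_nonsingular_iff[OF assms(1) Tred Tres] by (auto simp: nondegenerate_def)
  qed
  ultimately show ?thesis
    using iff by blast
qed

end
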